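(* Consider the click-through rate maximization model and its online algorithm with parameter $\epsilon>0$ described in the context, assume there exists $\hat{\mathbf p}\in\mathcal{F}$ with $\min_i\{N\sum_q\nu_q\sum_{M\in\mathcal{M}_q}\hat p_{qM}\sum_sM_{is}-m_i\}>0$, and let $\mathbf p^*$ be an optimal solution of $\max_{\mathbf p\in\mathcal{F}}\bar J(\mathbf p)$. Then for any $\epsilon>0$, $$0\le\lim_{K\to\infty}E\Big[\bar J(\mathbf p^* )-\frac{1}{KN}\sum_{k=0}^{K-1}J(k)\Big]\le\frac{D_1\epsilon}{N},$$ where $J(k)$ is the total number of click-through events in requirement cycle $k$ and $D_1=\frac12\big(N(N-1)L^2+NL+\sum_i(\lceil m_i\rceil^2(m_i-\lfloor m_i\rfloor)+\lfloor m_i\rfloor^2(1-m_i+\lfloor m_i\rfloor))\big)>0$.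
   Context: Model. Time is slotted; a requirement cycle $k$ consists of $N$ slots $kN,\dots,kN+N-1$. There are finitely many keywords $q\ge1$, clients $i=1,\dots,n$, and $L$ webpage slots $s=1,\dots,L$. For each $q$, $\mathcal{M}_q$ is a nonempty set of $n\times L$ $\{0,1\}$-matrices with at most one $1$ per row and per column ($M_{is}=1$ means client $i$'s ad is in slot $s$). In each slot $t$ the keyword $\tilde q(t)$ equals $q\ge1$ w.p. $\nu_q=\nu\vartheta_q$ and $0$ (no query) w.p. $1-\nu$, $\nu\in(0,1)$, $\sum_q\vartheta_q=1$, i.i.d. over $t$. Click-through rates $c_{qis}\in[0,1]$; click indicators $\tilde c_{qis}(t)\sim$ Bernoulli($c_{qis}$), independent across $q,i,s,t$ and of the queries. Client $i$ has an average impression requirement $m_i>0$ per cycle; $\tilde m_i(k)=\lceil m_i\rceil$ w.p. $m_i-\lfloor m_i\rfloor$ and $\lfloor m_i\rfloor$ otherwise, i.i.d. over $k$, independent of everything else. $\bar J(\mathbf p)=\sum_q\nu_q\sum_{M\in\mathcal{M}_q}p_{qM}\sum_{i,s}M_{is}c_{qis}$; $\mathcal{F}_0=\{\mathbf p:0\le p_{qM}\le1;\ \sum_{M\in\mathcal{M}_q}p_{qM}\le1\ \forall q\}$; $\mathcal{F}=\{\mathbf p\in\mathcal{F}_0:N\sum_q\nu_q\sum_{M\in\mathcal{M}_q}p_{qM}\sum_sM_{is}\ge m_i\ \forall i\}$. Online algorithm (parameter $\epsilon>0$): start from a finite nonnegative vector $\mathbf{Q}(0)$. In each slot $t$ of cycle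 $k$ with $\tilde q(t)=q>0$ use $\tilde M^*(q,\mathbf{Q}(k))\in\arg\max_{M\in\mathcal{M}_q}\sum_{i,s}M_{is}(c_{qis}/\epsilon+Q_i(k))$. $S_i(k)=\sum_{t=kN}^{kN+N-1}\sum_s[\tilde M^*(\tilde q(t),\mathbf{Q}(k))]_{is}$ (slots with no query contribute $0$); $Q_i(k+1)=\max\{Q_i(k)+\tilde m_i(k)-S_i(k),0\}$. The clicks in cycle $k$ are $J(k)=\sum_{t=kN}^{kN+N-1}\sum_{i,s}[\tilde M^*(\tilde q(t),\mathbf{Q}(k))]_{is}\tilde c_{\tilde q(t)is}(t)$. *)

theory Defs
  imports "HOL-Probability.Probability"
begin

text \<open>
  Clients and webpage slots are the elements of the finite types \<open>'n\<close> and \<open>'l\<close>, so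
  \<open>n = CARD('n)\<close> and \<open>L = CARD('l)\<close>; an ad placement is an \<open>n \<times> L\<close> matrix \<open>M :: real^'l^'n\<close>.
  Keywords are the numbers \<open>1..nq\<close>; the value \<open>0\<close> of a query variable means that there is no query.
  The probability of keyword \<open>q\<close> in a slot is \<open>\<nu> * \<theta> q\<close>, and \<open>\<M> q\<close> is its set of admissible
  placements.
\<close>

definition placement_matrix :: "real^'l^'n \<Rightarrow> bool" where
  "placement_matrix M \<longleftrightarrow>
     (\<forall>i s. M $ i $ s \<in> {0, 1}) \<and>
     (\<forall>i. card {s. M $ i $ s = 1} \<le> 1) \<and>
     (\<forall>s. card {i. M $ i $ s = 1} \<le> 1)"

lemma finite_placement_matrices: "finite {M :: real^'l^'n. placement_matrix M}"
proof (rule finite_subset)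
  show "{M :: real^'l^'n. placement_matrix M} \<subseteq> (\<lambda>b. \<chi> i s. of_bool (b i s)) ` UNIV"
  proof
    fix M :: "real^'l^'n"
    assume "M \<in> {M. placement_matrix M}"
    then have "M = (\<chi> i s. of_bool (M $ i $ s = 1))"
      by (auto simp: placement_matrix_def vec_eq_iff)
    then show "M \<in> (\<lambda>b. \<chi> i s. of_bool (b i s)) ` UNIV"
      by (rule image_eqI[where x = "\<lambda>i s. M $ i $ s = 1"]) simp
  qed
  show "finite ((\<lambda>b. (\<chi> i s. of_bool (b i s)) :: real^'l^'n) ` UNIV)"
    by (intro finite_imageI finite)
qed

subsection \<open>The static optimization problem\<close>

definition avg_clicks ::
  "nat \<Rightarrow> real \<Rightarrow> (nat \<Rightarrow> real) \<Rightarrow> (nat \<Rightarrow> (real^'l^'n) set) \<Rightarrow> (nat \<Rightarrow> 'n \<Rightarrow> 'l \<Rightarrow> real)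
    \<Rightarrow> (nat \<Rightarrow> real^'l^'n \<Rightarrow> real) \<Rightarrow> real" where
  "avg_clicks nq \<nu> \<theta> \<M> c p =
     (\<Sum>q=1..nq. \<nu> * \<theta> q * (\<Sum>M\<in>\<M> q. p q M * (\<Sum>i\<in>UNIV. \<Sum>s\<in>UNIV. M $ i $ s * c q i s)))"

definition avg_impressions ::
  "nat \<Rightarrow> nat \<Rightarrow> real \<Rightarrow> (nat \<Rightarrow> real) \<Rightarrow> (nat \<Rightarrow> (real^'l^'n) set)
    \<Rightarrow> (nat \<Rightarrow> real^'l^'n \<Rightarrow> real) \<Rightarrow> 'n \<Rightarrow> real" where
  "avg_impressions N nq \<nu> \<theta> \<M> p i =
     real N * (\<Sum>q=1..nq. \<nu> * \<theta> q * (\<Sum>M\<in>\<M> q. p q M * (\<Sum>s\<in>UNIV. M $ i $ s)))"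

definition randomizations ::
  "nat \<Rightarrow> (nat \<Rightarrow> (real^'l^'n) set) \<Rightarrow> (nat \<Rightarrow> real^'l^'n \<Rightarrow> real) set" where
  "randomizations nq \<M> =
     {p. \<forall>q\<in>{1..nq}. (\<forall>M\<in>\<M> q. 0 \<le> p q M \<and> p q M \<le> 1) \<and> (\<Sum>M\<in>\<M> q. p q M) \<le> 1}"

definition feasible ::
  "nat \<Rightarrow> nat \<Rightarrow> real \<Rightarrow> (nat \<Rightarrow> real) \<Rightarrow> (nat \<Rightarrow> (real^'l^'n) set) \<Rightarrow> ('n \<Rightarrow> real)
    \<Rightarrow> (nat \<Rightarrow> real^'l^'n \<Rightarrow> real) set" where
  "feasible N nq \<nu> \<theta> \<M> m =
     {p \<in> randomizations nq \<M>. \<forall>i. avg_impressions N nq \<nu> \<theta> \<M> p i \<ge> m i}"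

subsection \<open>The sources of randomness\<close>

datatype ('n, 'l) source = Query nat | Click nat 'n 'l nat | Requirement 'n nat

text \<open>
  All primitive random variables take values in \<open>nat\<close>, so that their mutual independence is
  independence of this single family.
\<close>

fun observation ::
  "(nat \<Rightarrow> 'w \<Rightarrow> nat) \<Rightarrow> (nat \<Rightarrow> 'n \<Rightarrow> 'l \<Rightarrow> nat \<Rightarrow> 'w \<Rightarrow> nat) \<Rightarrow> ('n \<Rightarrow> nat \<Rightarrow> 'w \<Rightarrow> nat)
    \<Rightarrow> ('n, 'l) source \<Rightarrow> 'w \<Rightarrow> nat" where
  "observation qt ct mt (Query t) = qt t"
| "observation qt ct mt (Click q i s t) = ct q i s t"
| "observation qt ct mt (Requirement i k) = mt i k"

definition sources :: "nat \<Rightarrow> ('n, 'l) source set" where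
  "sources nq = range Query \<union> {Click q i s t | q i s t. q \<in> {1..nq}}
     \<union> {Requirement i k | i k. True}"

text \<open>
  A random rounding of \<open>x\<close>. Written as an image of a Bernoulli distribution because the ceiling and
  the floor coincide when \<open>x\<close> is an integer.
\<close>

definition rounding_pmf :: "real \<Rightarrow> nat pmf" where
  "rounding_pmf x =
     map_pmf (\<lambda>b. if b then nat \<lceil>x\<rceil> else nat \<lfloor>x\<rfloor>) (bernoulli_pmf (x - of_int \<lfloor>x\<rfloor>))"

definition ctr_randomness ::
  "'w measure \<Rightarrow> nat \<Rightarrow> real \<Rightarrow> (nat \<Rightarrow> real) \<Rightarrow> (nat \<Rightarrow> 'n \<Rightarrow> 'l \<Rightarrow> real) \<Rightarrow> ('n \<Rightarrow> real)
    \<Rightarrow> (nat \<Rightarrow> 'w \<Rightarrow> nat) \<Rightarrow> (nat \<Rightarrow> 'n \<Rightarrow> 'l \<Rightarrow> nat \<Rightarrow> 'w \<Rightarrow> nat) \<Rightarrow> ('n \<Rightarrow> nat \<Rightarrow> 'w \<Rightarrow> nat) \<Rightarrow> bool" where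
  "ctr_randomness P nq \<nu> \<theta> c m qt ct mt \<longleftrightarrow>
     prob_space P \<and>
     prob_space.indep_vars P (\<lambda>_. count_space UNIV) (observation qt ct mt) (sources nq) \<and>
     (\<forall>t. \<forall>\<omega>\<in>space P. qt t \<omega> \<in> {0..nq}) \<and>
     (\<forall>t. measure P {\<omega> \<in> space P. qt t \<omega> = 0} = 1 - \<nu>) \<and>
     (\<forall>t. \<forall>q\<in>{1..nq}. measure P {\<omega> \<in> space P. qt t \<omega> = q} = \<nu> * \<theta> q) \<and>
     (\<forall>q\<in>{1..nq}. \<forall>i s t.
        distr P (count_space UNIV) (ct q i s t)
          = measure_pmf (map_pmf of_bool (bernoulli_pmf (c q i s)))) \<and>
     (\<forall>i k. distr P (count_space UNIV) (mt i k) = measure_pmf (rounding_pmf (m i)))"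

subsection \<open>The online algorithm\<close>

definition max_weight_rule ::
  "nat \<Rightarrow> (nat \<Rightarrow> (real^'l^'n) set) \<Rightarrow> (nat \<Rightarrow> 'n \<Rightarrow> 'l \<Rightarrow> real) \<Rightarrow> real
    \<Rightarrow> (nat \<Rightarrow> real^'n \<Rightarrow> real^'l^'n) \<Rightarrow> bool" where
  "max_weight_rule nq \<M> c \<epsilon> Mstar \<longleftrightarrow>
     (\<forall>q\<in>{1..nq}. \<forall>Q. (\<forall>i. 0 \<le> Q $ i) \<longrightarrow>
        is_arg_max (\<lambda>M. \<Sum>i\<in>UNIV. \<Sum>s\<in>UNIV. M $ i $ s * (c q i s / \<epsilon> + Q $ i))
          (\<lambda>M. M \<in> \<M> q) (Mstar q Q))"

definition shown :: "(nat \<Rightarrow> real^'n \<Rightarrow> real^'l^'n) \<Rightarrow> nat \<Rightarrow> real^'n \<Rightarrow> real^'l^'n" where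
  "shown Mstar q Q = (if q = 0 then 0 else Mstar q Q)"

definition impressions ::
  "nat \<Rightarrow> (nat \<Rightarrow> real^'n \<Rightarrow> real^'l^'n) \<Rightarrow> (nat \<Rightarrow> 'w \<Rightarrow> nat) \<Rightarrow> real^'n \<Rightarrow> nat \<Rightarrow> 'w \<Rightarrow> 'n \<Rightarrow> real" where
  "impressions N Mstar qt Q k \<omega> i =
     (\<Sum>t=k*N..<(k+1)*N. \<Sum>s\<in>UNIV. shown Mstar (qt t \<omega>) Q $ i $ s)"

primrec queue ::
  "nat \<Rightarrow> (nat \<Rightarrow> real^'n \<Rightarrow> real^'l^'n) \<Rightarrow> (nat \<Rightarrow> 'w \<Rightarrow> nat) \<Rightarrow> ('n \<Rightarrow> nat \<Rightarrow> 'w \<Rightarrow> nat)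
    \<Rightarrow> real^'n \<Rightarrow> nat \<Rightarrow> 'w \<Rightarrow> real^'n" where
  "queue N Mstar qt mt Q0 0 \<omega> = Q0"
| "queue N Mstar qt mt Q0 (Suc k) \<omega> =
     (\<chi> i. max (queue N Mstar qt mt Q0 k \<omega> $ i + real (mt i k \<omega>)
                 - impressions N Mstar qt (queue N Mstar qt mt Q0 k \<omega>) k \<omega> i) 0)"

definition clicks ::
  "nat \<Rightarrow> (nat \<Rightarrow> real^'n \<Rightarrow> real^'l^'n) \<Rightarrow> (nat \<Rightarrow> 'w \<Rightarrow> nat)
    \<Rightarrow> (nat \<Rightarrow> 'n \<Rightarrow> 'l \<Rightarrow> nat \<Rightarrow> 'w \<Rightarrow> nat) \<Rightarrow> ('n \<Rightarrow> nat \<Rightarrow> 'w \<Rightarrow> nat)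
    \<Rightarrow> real^'n \<Rightarrow> nat \<Rightarrow> 'w \<Rightarrow> real" where
  "clicks N Mstar qt ct mt Q0 k \<omega> =
     (\<Sum>t=k*N..<(k+1)*N. \<Sum>i\<in>UNIV. \<Sum>s\<in>UNIV.
        shown Mstar (qt t \<omega>) (queue N Mstar qt mt Q0 k \<omega>) $ i $ s * real (ct (qt t \<omega>) i s t \<omega>))"

end

theory Submission
  imports Defs "HOL-Complex_Analysis.Great_Picard"
begin

text \<open>
  The queue vectors form a Markov chain. Max-weight maximizes
  \<open>N * avg_clicks / \<epsilon> + \<Sum>\<^sub>i Q\<^sub>i * impressions\<^sub>i\<close> over all randomized placement rules. Hence,
  up to the constant \<open>D1\<close>, the drift of \<open>1/2 * \<Sum>\<^sub>i Q\<^sub>i\<^sup>2\<close> minus the expected clicks divided by \<open>\<epsilon>\<close> is at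
  most what any rule independent of the queues would give.
  Comparing with the optimal rule gives the upper bound. Comparing with the Slater point bounds the
  time-averaged mean queues and makes the mean queues \<open>O(sqrt K)\<close>; hence the time-averaged placement
  frequencies are asymptotically feasible, which gives the lower bound. The limit exists because
  bounded mean queues on a discrete lattice make the chain tight, and time averages of bounded
  functions along a tight discrete chain converge, even without irreducibility.
\<close>

subsection \<open>Time averages along a tight Markov chain\<close>

text \<open>Existence of the limit is part of the claim, and the estimates only confine the averages
  asymptotically to an interval of length \<open>D1 * \<epsilon> / N\<close>. Ties in the max-weight
  rule are broken arbitrarily, so no unique stationary law can be assumed; countability of the state
  space and tightness have to suffice.

  The lower bound need not hold for finite \<open>K\<close>: by underserving clients for a while the
  algorithm may collect more clicks than \<open>pstar\<close>. The mean shortfall of a client is at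
  most its mean queue at time \<open>K\<close>, so that queue must be o(K); bounded time averages
  alone do not directly control the queue at a single time, which is why the second moment is
  tracked as well.

  The sample space is arbitrary, but the queues up to any cycle depend on finitely many sources with
  values in the naturals. All laws are therefore carried over to product pmfs, and the original
  space returns only when expected clicks are computed.\<close>

lemma integrable_pmf_bounded:
  fixes f :: "'a \<Rightarrow> real"
  assumes "\<And>x. \<bar>f x\<bar> \<le> B"
  shows "integrable (measure_pmf p) f"
  using assms by (intro measure_pmf.integrable_const_bound[where B=B]) auto

lemma abs_expectation_pmf_le:
  fixes f :: "'a \<Rightarrow> real"
  assumes "\<And>x. \<bar>f x\<bar> \<le> B"
  shows "\<bar>measure_pmf.expectation p f\<bar> \<le> B"
proof -
  have "\<bar>measure_pmf.expectation p f\<bar> \<le> measure_pmf.expectation p (\<lambda>x. \<bar>f x\<bar>)"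
    by (rule integral_abs_bound)
  also have "\<dots> \<le> measure_pmf.expectation p (\<lambda>_. B)"
    by (intro integral_mono integrable_abs integrable_pmf_bounded[OF assms] assms) simp
  finally show ?thesis
    by simp
qed

lemma expectation_bind_pmf_bounded:
  fixes f :: "'a \<Rightarrow> real"
  assumes "\<And>x. \<bar>f x\<bar> \<le> B"
  shows "measure_pmf.expectation (bind_pmf p \<kappa>) f
           = measure_pmf.expectation p (\<lambda>x. measure_pmf.expectation (\<kappa> x) f)"
  unfolding measure_pmf_bind
  by (subst integral_bind[where K="count_space UNIV" and B'=1 and B=B])
     (use assms in \<open>auto simp: measure_pmf.emeasure_space_1 intro!: prob_space_imp_subprob_space
        measure_pmf.prob_space_axioms simp: space_subprob_algebra\<close>)

text \<open>
  If a subsequence of the averages \<open>h n\<close> of the iterates of \<open>f\<close> under the transition operator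
  converges pointwise, its limit \<open>H\<close> is harmonic, so the expectation of \<open>H\<close> does not depend on
  time. Averaging \<open>h n\<close> along the chain changes the averages of \<open>f\<close> only by \<open>O(n/K)\<close>, while
  tightness makes the averages of \<open>h n\<close> close to those of \<open>H\<close> uniformly in \<open>K\<close>.
\<close>
theorem tight_chain_cesaro_convergent:
  fixes \<kappa> :: "'a \<Rightarrow> 'a pmf" and \<mu> :: "nat \<Rightarrow> 'a pmf" and f :: "'a \<Rightarrow> real"
  assumes step: "\<And>k. \<mu> (Suc k) = bind_pmf (\<mu> k) \<kappa>"
    and tight: "\<And>e. 0 < e \<Longrightarrow> \<exists>F. finite F \<and> (\<forall>K. (\<Sum>k<K. measure_pmf.prob (\<mu> k) (-F)) \<le> e * real K)"
    and f_bound: "\<And>x. \<bar>f x\<bar> \<le> B"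
  shows "convergent (\<lambda>K. (\<Sum>k<K. measure_pmf.expectation (\<mu> k) f) / real K)"
proof -
  define T where "T g x = measure_pmf.expectation (\<kappa> x) g" for g :: "'a \<Rightarrow> real" and x
  define A where "A K g = (\<Sum>k<K. measure_pmf.expectation (\<mu> k) g) / real K" for K and g :: "'a \<Rightarrow> real"
  define it where "it j = (T ^^ j) f" for j
  define h where "h n x = (\<Sum>j<n. it j x) / real n" for n x
  define S where "S = (\<Union>k. set_pmf (\<mu> k))"
  have B0: "0 \<le> B"
    using f_bound[of undefined] by linarith
  have T_bound: "\<bar>T g x\<bar> \<le> B" if "\<And>x. \<bar>g x\<bar> \<le> B" for g x
    unfolding T_def using that by (rule abs_expectation_pmf_le)
  have it_Suc: "it (Suc j) = T (it j)" and it_0: "it 0 = f" for j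
    by (simp_all add: it_def)
  have it_bound: "\<bar>it j x\<bar> \<le> B" for j x
  proof (induction j arbitrary: x)
    case 0
    then show ?case using f_bound by (simp add: it_0)
  next
    case (Suc j)
    then show ?case unfolding it_Suc by (rule T_bound)
  qed
  have h_bound: "\<bar>h n x\<bar> \<le> B" for n x
  proof (cases "n = 0")
    case True
    then show ?thesis using B0 by (simp add: h_def)
  next
    case False
    have "\<bar>\<Sum>j<n. it j x\<bar> \<le> (\<Sum>j<n. B)"
      by (rule order_trans[OF sum_abs sum_mono]) (rule it_bound)
    then show ?thesis using False by (simp add: h_def field_simps)
  qed
  have S_countable: "countable S"
    by (simp add: S_def)
  have S_closed: "set_pmf (\<kappa> x) \<subseteq> S" if "x \<in> S" for x
  proof -
    from that obtain k where "x \<in> set_pmf (\<mu> k)" by (auto simp: S_def)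
    then have "set_pmf (\<kappa> x) \<subseteq> set_pmf (\<mu> (Suc k))" by (auto simp: step)
    then show ?thesis by (auto simp: S_def)
  qed
  \<comment> \<open>Diagonal extraction applies because pmfs have countable support, so the set
    \<open>S\<close> of all reachable states is countable.\<close>
  obtain r where r: "strict_mono r" and r_lim: "\<And>x. x \<in> S \<Longrightarrow> \<exists>l. (\<lambda>n. h (r n) x) \<longlonglongrightarrow> l"
    using function_convergent_subsequence[OF S_countable, of h B] h_bound by auto
  \<comment> \<open>Off \<open>S\<close> the limit need not exist; the value 0 keeps
    \<open>H\<close> bounded by \<open>B\<close>, and the chain never sees it.\<close>
  define H where "H x = (if x \<in> S then lim (\<lambda>n. h (r n) x) else 0)" for x
  have H_lim: "(\<lambda>n. h (r n) x) \<longlonglongrightarrow> H x" if "x \<in> S" for x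
    using r_lim[OF that] that by (auto simp: H_def limI)
  have H_bound: "\<bar>H x\<bar> \<le> B" for x
  proof (cases "x \<in> S")
    case True
    have "(\<lambda>n. \<bar>h (r n) x\<bar>) \<longlonglongrightarrow> \<bar>H x\<bar>"
      by (intro tendsto_rabs H_lim True)
    then show ?thesis
      by (rule LIMSEQ_le_const2) (use h_bound in auto)
  next
    case False
    then show ?thesis using B0 by (simp add: H_def)
  qed
  have T_h: "T (h n) x = (\<Sum>j<n. it (Suc j) x) / real n" for n x
    unfolding T_def h_def it_Suc
    by (simp add: Bochner_Integration.integral_sum integrable_pmf_bounded[OF it_bound])
  have T_H: "T H x = H x" if "x \<in> S" for x
  proof -
    have "(\<lambda>n. T (h (r n)) x) \<longlonglongrightarrow> T H x"
      unfolding T_def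
    proof (rule integral_dominated_convergence[where w="\<lambda>_. B"])
      show "AE y in measure_pmf (\<kappa> x). (\<lambda>n. h (r n) y) \<longlonglongrightarrow> H y"
        using S_closed[OF that] by (auto intro!: AE_pmfI H_lim)
    qed (use h_bound in auto)
    \<comment> \<open>Applying \<open>T\<close> shifts the window of iterates by one, so only the
      two end terms survive, divided by the window length.\<close>
    moreover have "(\<lambda>n. T (h (r n)) x - h (r n) x) \<longlonglongrightarrow> 0"
    proof -
      have diff: "T (h n) x - h n x = (it n x - it 0 x) / real n" for n
        unfolding T_h h_def using sum_lessThan_telescope[of "\<lambda>j. it j x" n]
        by (simp add: sum_subtractf flip: diff_divide_distrib)
      have "(\<lambda>n. T (h n) x - h n x) \<longlonglongrightarrow> 0"
      proof (rule Lim_null_comparison)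
        show "\<forall>\<^sub>F n in sequentially. norm (T (h n) x - h n x) \<le> 2 * B / real n"
        proof (intro always_eventually allI)
          fix n
          have "\<bar>it n x - it 0 x\<bar> \<le> 2 * B"
            using it_bound[of n x] it_bound[of 0 x] by linarith
          then show "norm (T (h n) x - h n x) \<le> 2 * B / real n"
            unfolding diff by (simp add: divide_right_mono)
        qed
        show "(\<lambda>n. 2 * B / real n) \<longlonglongrightarrow> 0"
          by (rule lim_const_over_n)
      qed
      from LIMSEQ_subseq_LIMSEQ[OF this r] show ?thesis by (simp add: o_def)
    qed
    ultimately have "(\<lambda>n. T (h (r n)) x - (T (h (r n)) x - h (r n) x)) \<longlonglongrightarrow> T H x - 0"
      by (rule tendsto_diff)
    then have "(\<lambda>n. h (r n) x) \<longlonglongrightarrow> T H x" by simp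
    with H_lim[OF that] show ?thesis by (rule LIMSEQ_unique[rotated])
  qed
  have E_Suc: "measure_pmf.expectation (\<mu> (Suc k)) g = measure_pmf.expectation (\<mu> k) (T g)"
    if "\<And>x. \<bar>g x\<bar> \<le> B" for g k
    unfolding step T_def by (rule expectation_bind_pmf_bounded) (rule that)
  have E_H: "measure_pmf.expectation (\<mu> k) H = measure_pmf.expectation (\<mu> 0) H" for k
  proof (induction k)
    case (Suc k)
    have "measure_pmf.expectation (\<mu> k) (T H) = measure_pmf.expectation (\<mu> k) H"
      by (intro integral_cong_AE AE_pmfI) (auto simp: S_def intro!: T_H)
    with Suc show ?case by (simp add: E_Suc[OF H_bound])
  qed simp
  have A_H: "A K H = measure_pmf.expectation (\<mu> 0) H" if "K > 0" for K
  proof -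
    have "(\<Sum>k<K. measure_pmf.expectation (\<mu> k) H) = (\<Sum>k<K. measure_pmf.expectation (\<mu> 0) H)"
      by (intro sum.cong refl E_H)
    then show ?thesis using that by (simp add: A_def)
  qed
  \<comment> \<open>Passing from \<open>it j\<close> to \<open>T (it j)\<close> moves the time
    window by one cycle and exchanges two boundary expectations, each at most \<open>B\<close> in
    absolute value.\<close>
  have A_it: "\<bar>A K (it j) - A K f\<bar> \<le> 2 * B * real j / real K" for K j
  proof (induction j)
    case (Suc j)
    let ?E = "\<lambda>k. measure_pmf.expectation (\<mu> k) (it j)"
    have "A K (it (Suc j)) - A K (it j) = (?E K - ?E 0) / real K"
      unfolding A_def it_Suc using sum_lessThan_telescope[of ?E K]
      by (simp add: E_Suc[OF it_bound] sum_subtractf flip: diff_divide_distrib)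
    moreover have "\<bar>?E K - ?E 0\<bar> \<le> 2 * B"
      using abs_expectation_pmf_le[where f="it j" and p="\<mu> K", OF it_bound]
        abs_expectation_pmf_le[where f="it j" and p="\<mu> 0", OF it_bound] by linarith
    ultimately have "\<bar>A K (it (Suc j)) - A K (it j)\<bar> \<le> 2 * B / real K"
      by (simp add: divide_right_mono)
    moreover have "2 * B * real (Suc j) / real K = 2 * B * real j / real K + 2 * B / real K"
      by (simp add: algebra_simps add_divide_distrib)
    ultimately show ?case using Suc by linarith
  qed (simp add: it_0)
  have A_h: "\<bar>A K (h n) - A K f\<bar> \<le> 2 * B * real n / real K" if "n > 0" for K n
  proof -
    have "A K (h n) = (\<Sum>j<n. A K (it j)) / real n"
      unfolding A_def h_def
      by (simp add: Bochner_Integration.integral_sum integrable_pmf_bounded[OF it_bound]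
          sum_divide_distrib[symmetric] sum.swap[of _ "{..<n}"] mult.commute)
    then have "A K (h n) - A K f = (\<Sum>j<n. A K (it j) - A K f) / real n"
      using that by (simp add: sum_subtractf field_simps)
    also have "\<bar>\<dots>\<bar> = \<bar>\<Sum>j<n. A K (it j) - A K f\<bar> / real n"
      by simp
    also have "\<dots> \<le> (\<Sum>j<n. 2 * B * real n / real K) / real n"
    proof (intro divide_right_mono order_trans[OF sum_abs sum_mono])
      fix j assume "j \<in> {..<n}"
      then have "2 * B * real j / real K \<le> 2 * B * real n / real K"
        using B0 by (intro divide_right_mono mult_left_mono) auto
      then show "\<bar>A K (it j) - A K f\<bar> \<le> 2 * B * real n / real K"
        using A_it[of K j] by linarith
    qed simp
    also have "\<dots> = 2 * B * real n / real K" using that by simp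
    finally show ?thesis .
  qed
  have "(\<lambda>K. A K f) \<longlonglongrightarrow> measure_pmf.expectation (\<mu> 0) H"
  proof (rule LIMSEQ_I)
    fix e :: real assume e: "0 < e"
    \<comment> \<open>The factor 8 gives \<open>2 * B * d \<le> e / 4\<close>; the added 8 keeps the
      denominator positive when \<open>B = 0\<close>.\<close>
    define d where "d = e / (8 * B + 8)"
    have d: "0 < d" "2 * B * d \<le> e / 4"
      using e B0 by (auto simp: d_def field_simps)
    from tight[OF d(1)] obtain F where F: "finite F"
      and tail: "\<And>K. (\<Sum>k<K. measure_pmf.prob (\<mu> k) (-F)) \<le> d * real K" by blast
    have "\<forall>\<^sub>F n in sequentially. \<forall>x\<in>F \<inter> S. \<bar>h (r n) x - H x\<bar> < e / 4"
    proof (rule eventually_ball_finite)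
      show "\<forall>x\<in>F \<inter> S. \<forall>\<^sub>F n in sequentially. \<bar>h (r n) x - H x\<bar> < e / 4"
      proof
        fix x assume "x \<in> F \<inter> S"
        then have "(\<lambda>n. h (r n) x) \<longlonglongrightarrow> H x" by (intro H_lim) auto
        from tendstoD[OF this, of "e/4"] e show "\<forall>\<^sub>F n in sequentially. \<bar>h (r n) x - H x\<bar> < e / 4"
          by (simp add: dist_real_def)
      qed
    qed (use F in auto)
    then obtain n1 where n1: "\<And>n x. n \<ge> n1 \<Longrightarrow> x \<in> F \<inter> S \<Longrightarrow> \<bar>h (r n) x - H x\<bar> < e / 4"
      by (auto simp: eventually_sequentially)
    \<comment> \<open>The successor forces \<open>n > 0\<close>, since \<open>r\<close> is strictly
      increasing; \<open>h n\<close> divides by \<open>n\<close>.\<close>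
    define n where "n = r (Suc n1)"
    have n0: "n > 0" using seq_suble[OF r, of "Suc n1"] by (simp add: n_def)
    have n: "\<bar>h n x - H x\<bar> < e / 4" if "x \<in> F" "x \<in> S" for x
      unfolding n_def by (rule n1) (use that in auto)
    have close: "\<bar>A K (h n) - A K H\<bar> \<le> e / 2" if K: "K > 0" for K
    proof -
      have "\<bar>measure_pmf.expectation (\<mu> k) (h n) - measure_pmf.expectation (\<mu> k) H\<bar>
              \<le> e / 4 + 2 * B * measure_pmf.prob (\<mu> k) (-F)" for k
      proof -
        have "\<bar>measure_pmf.expectation (\<mu> k) (h n) - measure_pmf.expectation (\<mu> k) H\<bar>
            = \<bar>measure_pmf.expectation (\<mu> k) (\<lambda>x. h n x - H x)\<bar>"
          by (simp add: integrable_pmf_bounded[OF h_bound] integrable_pmf_bounded[OF H_bound])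
        also have "\<dots> \<le> measure_pmf.expectation (\<mu> k) (\<lambda>x. \<bar>h n x - H x\<bar>)"
          by (rule integral_abs_bound)
        also have "\<dots> \<le> measure_pmf.expectation (\<mu> k) (\<lambda>x. e / 4 + 2 * B * indicator (-F) x)"
        proof (intro integral_mono_AE AE_pmfI)
          show "integrable (measure_pmf (\<mu> k)) (\<lambda>x. \<bar>h n x - H x\<bar>)"
            by (intro integrable_abs Bochner_Integration.integrable_diff
                integrable_pmf_bounded[OF h_bound] integrable_pmf_bounded[OF H_bound])
          fix x assume "x \<in> set_pmf (\<mu> k)"
          then have "x \<in> S" by (auto simp: S_def)
          then show "\<bar>h n x - H x\<bar> \<le> e / 4 + 2 * B * indicator (-F) x"
            using n[of x] h_bound[of n x] H_bound[of x] e by (cases "x \<in> F") auto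
        qed (auto intro!: integrable_pmf_bounded[where B="e/4 + 2 * B"] simp: B0 e less_imp_le indicator_def)
        also have "\<dots> = e / 4 + 2 * B * measure_pmf.prob (\<mu> k) (-F)"
        proof -
          have "integrable (measure_pmf (\<mu> k)) (indicat_real (-F))"
            by (rule integrable_pmf_bounded[where B=1]) (simp add: indicator_def)
          then show ?thesis by simp
        qed
        finally show ?thesis .
      qed
      note bnd = this
      have "A K (h n) - A K H
          = (\<Sum>k<K. measure_pmf.expectation (\<mu> k) (h n) - measure_pmf.expectation (\<mu> k) H) / real K"
        by (simp add: A_def sum_subtractf diff_divide_distrib)
      also have "\<bar>\<dots>\<bar> = \<bar>\<Sum>k<K. measure_pmf.expectation (\<mu> k) (h n) - measure_pmf.expectation (\<mu> k) H\<bar> / real K"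
        by simp
      also have "\<dots> \<le> (\<Sum>k<K. e / 4 + 2 * B * measure_pmf.prob (\<mu> k) (-F)) / real K"
        by (intro divide_right_mono order_trans[OF sum_abs sum_mono] bnd) auto
      also have "\<dots> = e / 4 + 2 * B * (\<Sum>k<K. measure_pmf.prob (\<mu> k) (-F)) / real K"
        using K by (simp add: sum.distrib sum_distrib_left add_divide_distrib)
      also have "\<dots> \<le> e / 4 + 2 * B * (d * real K) / real K"
        using tail[of K] B0 by (intro add_left_mono divide_right_mono mult_left_mono) auto
      also have "\<dots> \<le> e / 2" using K d by simp
      finally show ?thesis .
    qed
    obtain K0 where K0: "2 * B * real n * 4 / e < real K0"
      using reals_Archimedean2 by blast
    show "\<exists>K0. \<forall>K\<ge>K0. norm (A K f - measure_pmf.expectation (\<mu> 0) H) < e"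
    proof (intro exI[of _ "Suc K0"] allI impI)
      fix K assume K: "K \<ge> Suc K0"
      then have Kpos: "K > 0" by simp
      have "2 * B * real n * 4 / e < real K" using K0 K by linarith
      then have "2 * B * real n / real K < e / 4"
        using e Kpos by (simp add: field_simps)
      then show "norm (A K f - measure_pmf.expectation (\<mu> 0) H) < e"
        using A_h[OF n0, of K] close[OF Kpos] A_H[OF Kpos] e
        unfolding real_norm_def by linarith
    qed
  qed
  then show ?thesis
    unfolding A_def by (rule convergentI)
qed

subsection \<open>The joint law of the observations and the queue chain\<close>

text \<open>The function space may be uncountable while every subset counts as measurable. Padding
  with \<open>d\<close> outside the finite \<open>I\<close> confines both laws to the countable set
  \<open>S\<close>, where measurability and equality can be checked on singletons.\<close>

lemma (in prob_space) distr_indep_vars_eq_Pi_pmf: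
  fixes X :: "'i \<Rightarrow> 'a \<Rightarrow> 'b::countable"
  assumes I: "finite I"
    and indep: "indep_vars (\<lambda>_. count_space UNIV) X I"
    and law: "\<And>i. i \<in> I \<Longrightarrow> distr M (count_space UNIV) (X i) = measure_pmf (D i)"
  shows "(\<lambda>\<omega> i. if i \<in> I then X i \<omega> else d) \<in> measurable M (count_space UNIV)"
    and "distr M (count_space UNIV) (\<lambda>\<omega> i. if i \<in> I then X i \<omega> else d) = measure_pmf (Pi_pmf I d D)"
proof -
  let ?V = "\<lambda>\<omega> i. if i \<in> I then X i \<omega> else d"
  define S where "S = PiE_dflt I d (\<lambda>_. UNIV :: 'b set)"
  have S: "countable S"
    unfolding S_def dflt_image_PiE[symmetric] using I by (intro countable_image countable_PiE) auto
  have X: "X i \<in> measurable M (count_space UNIV)" if "i \<in> I" for i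
    using indep that by (auto simp: indep_vars_def)
  have V_S: "?V \<omega> \<in> S" for \<omega>
    by (auto simp: S_def PiE_dflt_def)
  have pre: "?V -` {f} \<inter> space M = {\<omega> \<in> space M. \<forall>i\<in>I. X i \<omega> = f i}" if "f \<in> S" for f
    using that by (auto simp: S_def PiE_dflt_def fun_eq_iff)
  have single: "{\<omega> \<in> space M. \<forall>i\<in>I. X i \<omega> = f i} \<in> events" for f
  proof -
    have "{\<omega> \<in> space M. X i \<omega> = f i} \<in> events" if "i \<in> I" for i
      using measurable_sets[OF X[OF that], of "{f i}"] by (simp add: vimage_def Int_def conj_commute)
    then show ?thesis using I by (rule sets.sets_Collect_finite_All)
  qed
  show V: "?V \<in> measurable M (count_space UNIV)"
  proof (rule measurableI)
    fix A :: "('i \<Rightarrow> 'b) set"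
    have "?V -` A \<inter> space M = (\<Union>f\<in>A \<inter> S. ?V -` {f} \<inter> space M)"
      using V_S by auto
    also have "\<dots> \<in> events"
      using single pre S by (intro sets.countable_UN'') auto
    finally show "?V -` A \<inter> space M \<in> events" .
  qed simp
  show "distr M (count_space UNIV) ?V = measure_pmf (Pi_pmf I d D)"
  proof (rule measure_eqI_countable_AE[where \<Omega>=S])
    show "AE f in distr M (count_space UNIV) ?V. f \<in> S"
      using V V_S by (subst AE_distr_iff) auto
    show "AE f in measure_pmf (Pi_pmf I d D). f \<in> S"
      using set_Pi_pmf_subset[OF I] by (fastforce simp: AE_measure_pmf_iff S_def PiE_dflt_def)
    fix f assume f: "f \<in> S"
    have "prob (?V -` {f} \<inter> space M) = (\<Prod>i\<in>I. pmf (D i) (f i))"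
    proof (cases "I = {}")
      case True
      then have "?V -` {f} \<inter> space M = space M"
        using f by (auto simp: S_def PiE_dflt_def fun_eq_iff)
      then show ?thesis using True by (simp add: prob_space)
    next
      case False
      have "?V -` {f} \<inter> space M = (\<Inter>i\<in>I. X i -` {f i} \<inter> space M)"
        unfolding pre[OF f] using False by auto
      then have "prob (?V -` {f} \<inter> space M) = (\<Prod>i\<in>I. prob (X i -` {f i} \<inter> space M))"
        using indep_varsD_finite[OF indep False I, of "\<lambda>i. {f i}"] by simp
      also have "\<dots> = (\<Prod>i\<in>I. pmf (D i) (f i))"
      proof (intro prod.cong refl)
        fix i assume "i \<in> I"
        then show "prob (X i -` {f i} \<inter> space M) = pmf (D i) (f i)"
          using measure_distr[OF X, of i "{f i}"] law[of i] by (simp add: pmf.rep_eq)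
      qed
      finally show ?thesis .
    qed
    moreover have "pmf (Pi_pmf I d D) f = (\<Prod>i\<in>I. pmf (D i) (f i))"
      using f I by (intro pmf_Pi') (auto simp: S_def PiE_dflt_def)
    ultimately show "emeasure (distr M (count_space UNIV) ?V) {f} = emeasure (measure_pmf (Pi_pmf I d D)) {f}"
      using V by (simp add: emeasure_distr emeasure_eq_measure emeasure_pmf_single)
  qed (use S in auto)
qed

text \<open>Coordinates are peeled off one at a time; injectivity keeps \<open>h x\<close> apart
  from the remaining ones. This serves to read the data of cycle \<open>k\<close> as data of cycle
  0.\<close>

lemma map_Pi_pmf_reindex:
  assumes J: "finite J" and h: "inj_on h J"
  shows "map_pmf (\<lambda>v j. if j \<in> J then v (h j) else d) (Pi_pmf (h ` J) d D) = Pi_pmf J d (\<lambda>j. D (h j))"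
  using J h
proof (induction J)
  case (insert x J)
  have fresh: "h x \<notin> h ` J"
    using insert.prems insert.hyps by auto
  have upd: "(\<lambda>j. if j \<in> insert x J then (f(h x := y)) (h j) else d)
      = (\<lambda>j. if j \<in> J then f (h j) else d)(x := y)" for f y
    using fresh by (auto simp: fun_eq_iff image_iff)
  have "map_pmf (\<lambda>v j. if j \<in> insert x J then v (h j) else d) (Pi_pmf (h ` insert x J) d D)
      = map_pmf (\<lambda>(y, f). f(x := y))
          (map_pmf (\<lambda>(y, f). (y, \<lambda>j. if j \<in> J then f (h j) else d))
            (pair_pmf (D (h x)) (Pi_pmf (h ` J) d D)))"
    unfolding image_insert using insert.hyps fresh
    by (subst Pi_pmf_insert) (simp_all only: finite_imageI map_pmf_comp case_prod_beta fst_conv snd_conv upd not_False_eq_True)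
  also have "map_pmf (\<lambda>(y, f). (y, \<lambda>j. if j \<in> J then f (h j) else d))
            (pair_pmf (D (h x)) (Pi_pmf (h ` J) d D)) = pair_pmf (D (h x)) (Pi_pmf J d (\<lambda>j. D (h j)))"
    using map_pair[where f="\<lambda>y. y" and g="\<lambda>f j. if j \<in> J then f (h j) else d"
        and A="D (h x)" and B="Pi_pmf (h ` J) d D"] insert by simp
  finally show ?case
    by (simp only: Pi_pmf_insert[OF insert.hyps])
qed simp

lemma expectation_bind_pmf_finite:
  fixes f :: "'b \<Rightarrow> real"
  assumes "finite (set_pmf p)" "\<And>x. x \<in> set_pmf p \<Longrightarrow> finite (set_pmf (\<kappa> x))"
  shows "measure_pmf.expectation (bind_pmf p \<kappa>) f
           = measure_pmf.expectation p (\<lambda>x. measure_pmf.expectation (\<kappa> x) f)"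
proof -
  have "measure_pmf.expectation (bind_pmf p \<kappa>) f
      = (\<Sum>x\<in>set_pmf p. pmf p x *\<^sub>R measure_pmf.expectation (\<kappa> x) f)"
    using assms by (intro pmf_expectation_bind) auto
  also have "\<dots> = measure_pmf.expectation p (\<lambda>x. measure_pmf.expectation (\<kappa> x) f)"
    using assms by (subst integral_measure_pmf[of "set_pmf p"]) auto
  finally show ?thesis .
qed

lemma expectation_pair_pmf_finite:
  fixes f :: "'a \<times> 'b \<Rightarrow> real"
  assumes "finite (set_pmf p)" "finite (set_pmf q)"
  shows "measure_pmf.expectation (pair_pmf p q) f
           = measure_pmf.expectation p (\<lambda>x. measure_pmf.expectation q (\<lambda>y. f (x, y)))"
  unfolding pair_pmf_def using assms
  by (simp add: expectation_bind_pmf_finite)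

text \<open>Causality of the algorithm. The two sides may live on different sample spaces, which
  lets the queue be computed from a bare vector of source values.\<close>

lemma queue_cong:
  assumes "\<And>t. t < k * N \<Longrightarrow> qt t \<omega> = qt' t \<omega>'"
    and "\<And>i j. j < k \<Longrightarrow> mt i j \<omega> = mt' i j \<omega>'"
  shows "queue N Mstar qt mt Q k \<omega> = queue N Mstar qt' mt' Q k \<omega>'"
  using assms
proof (induction k)
  case (Suc k)
  have "queue N Mstar qt mt Q k \<omega> = queue N Mstar qt' mt' Q k \<omega>'"
    using Suc.prems by (intro Suc.IH) auto
  moreover have "impressions N Mstar qt R k \<omega> i = impressions N Mstar qt' R k \<omega>' i" for R i
    unfolding impressions_def using Suc.prems by (intro sum.cong refl) auto
  ultimately show ?case using Suc.prems by simp
qed simp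

section \<open>Stationarity and independence of the cycles\<close>

fun shift_source :: "nat \<Rightarrow> nat \<Rightarrow> ('n, 'l) source \<Rightarrow> ('n, 'l) source" where
  "shift_source N k (Query t) = Query (k * N + t)"
| "shift_source N k (Click q i s t) = Click q i s (k * N + t)"
| "shift_source N k (Requirement i j) = Requirement i (k + j)"

text \<open>Clicks are left out because the queues never react to them; every click is therefore
  independent of these sources.\<close>

definition sources_upto :: "nat \<Rightarrow> nat \<Rightarrow> ('n, 'l) source set" where
  "sources_upto N k = Query ` {..<k * N} \<union> (\<lambda>(i, j). Requirement i j) ` (UNIV \<times> {..<k})"

lemma finite_sources_upto: "finite (sources_upto N k :: ('n::finite, 'l) source set)"
  by (simp add: sources_upto_def)

lemma Query_in_sources_upto [simp]: "Query t \<in> sources_upto N k \<longleftrightarrow> t < k * N"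
  and Requirement_in_sources_upto [simp]: "Requirement i j \<in> sources_upto N k \<longleftrightarrow> j < k"
  and Click_in_sources_upto [simp]: "Click q i s t \<notin> sources_upto N k"
  by (auto simp: sources_upto_def)

lemma sources_upto_cases [consumes 1]:
  assumes "x \<in> sources_upto N k"
  obtains t where "x = Query t" "t < k * N" | i j where "x = Requirement i j" "j < k"
  using assms by (auto simp: sources_upto_def)

lemma inj_on_shift_source: "inj_on (shift_source N k) A"
proof (rule inj_onI)
  fix x y :: "('a, 'b) source"
  assume "shift_source N k x = shift_source N k y"
  then show "x = y" by (cases x; cases y) auto
qed

lemma sources_upto_Suc:
  "sources_upto N (Suc k) = sources_upto N k \<union> shift_source N k ` sources_upto N (Suc 0)"
proof (rule set_eqI)
  fix x :: "('a, 'b) source"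
  show "x \<in> sources_upto N (Suc k) \<longleftrightarrow> x \<in> sources_upto N k \<union> shift_source N k ` sources_upto N (Suc 0)"
  proof (cases x)
    case (Query t)
    have "Query t \<in> shift_source N k ` sources_upto N (Suc 0)" if "k * N \<le> t" "t < Suc k * N"
      using that by (intro image_eqI[of _ _ "Query (t - k * N)"]) auto
    moreover have "k * N \<le> t \<and> t < Suc k * N" if "Query t \<in> shift_source N k ` (sources_upto N (Suc 0) :: ('a, 'b) source set)"
      using that by (auto elim: sources_upto_cases)
    moreover have "t < k * N \<or> k * N \<le> t" by linarith
    ultimately show ?thesis by (auto simp: Query)
  next
    case (Requirement i j)
    have "Requirement i k \<in> shift_source N k ` sources_upto N (Suc 0)"
      by (intro image_eqI[of _ _ "Requirement i 0"]) auto
    moreover have "j = k" if "Requirement i j \<in> shift_source N k ` (sources_upto N (Suc 0) :: ('a, 'b) source set)"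
      using that by (auto elim: sources_upto_cases)
    ultimately show ?thesis by (auto simp: Requirement less_Suc_eq)
  qed (auto elim!: sources_upto_cases)
qed

lemma sources_upto_disjoint: "sources_upto N k \<inter> shift_source N k ` sources_upto N (Suc 0) = {}"
  by (auto elim!: sources_upto_cases)

text \<open>The queue on the canonical sample space, where a sample point assigns a value to every
  source.\<close>

definition coordinate_queue ::
  "nat \<Rightarrow> (nat \<Rightarrow> real^'n \<Rightarrow> real^'l^'n) \<Rightarrow> real^'n \<Rightarrow> nat \<Rightarrow> (('n, 'l) source \<Rightarrow> nat) \<Rightarrow> real^'n" where
  "coordinate_queue N Mstar =
     queue N Mstar (\<lambda>t v. v (Query t)) (\<lambda>i j v. v (Requirement i j))"

text \<open>The value 0 outside one cycle matches the default of \<open>Pi_pmf\<close>, so that the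
  law becomes exactly \<open>cycle_pmf\<close>.\<close>

definition cycle_data :: "nat \<Rightarrow> nat \<Rightarrow> (('n, 'l) source \<Rightarrow> nat) \<Rightarrow> ('n, 'l) source \<Rightarrow> nat" where
  "cycle_data N k v x = (if x \<in> sources_upto N (Suc 0) then v (shift_source N k x) else 0)"

lemma coordinate_queue_0 [simp]: "coordinate_queue N Mstar Q 0 v = Q"
  by (simp add: coordinate_queue_def)

text \<open>Time homogeneity: the rule consults only the current queue and query, so a later cycle
  is a first cycle restarted from the current queue.\<close>

lemma coordinate_queue_Suc:
  "coordinate_queue N Mstar Q (Suc k) v
     = coordinate_queue N Mstar (coordinate_queue N Mstar Q k v) (Suc 0) (cycle_data N k v)"
proof -
  have "(\<Sum>t=k*N..<(k+1)*N. g t) = (\<Sum>t=0..<N. g (k * N + t))" for g :: "nat \<Rightarrow> real"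
    using sum.shift_bounds_nat_ivl[of g 0 "k * N" N] by (simp add: add.commute)
  then show ?thesis
    by (simp add: coordinate_queue_def impressions_def vec_eq_iff cycle_data_def)
qed

lemma coordinate_queue_cong:
  assumes "\<And>x. x \<in> sources_upto N k \<Longrightarrow> v x = v' x"
  shows "coordinate_queue N Mstar Q k v = coordinate_queue N Mstar Q k v'"
  unfolding coordinate_queue_def using assms by (intro queue_cong) auto

definition cycle_pmf :: "nat \<Rightarrow> (('n::finite, 'l) source \<Rightarrow> nat pmf) \<Rightarrow> (('n, 'l) source \<Rightarrow> nat) pmf" where
  "cycle_pmf N D = Pi_pmf (sources_upto N (Suc 0)) 0 D"

primrec queue_pmf ::
  "nat \<Rightarrow> (nat \<Rightarrow> real^'n \<Rightarrow> real^'l^'n) \<Rightarrow> (('n, 'l) source \<Rightarrow> nat pmf) \<Rightarrow> real^'n \<Rightarrow> nat \<Rightarrow> (real^'n) pmf" where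
  "queue_pmf N Mstar D Q0 0 = return_pmf Q0"
| "queue_pmf N Mstar D Q0 (Suc k) = bind_pmf (queue_pmf N Mstar D Q0 k)
     (\<lambda>Q. map_pmf (coordinate_queue N Mstar Q (Suc 0)) (cycle_pmf N D))"

text \<open>The queue uses only sources before cycle \<open>k\<close>, the cycle data only those of
  cycle \<open>k\<close>, and \<open>Pi_pmf\<close> over a disjoint union is a product. The joint
  law is kept because the clicks of a cycle involve both its queries and its initial queue.\<close>

lemma map_queue_cycle_data:
  fixes D :: "('n::finite, 'l::finite) source \<Rightarrow> nat pmf"
  assumes D: "\<And>x. D (shift_source N k x) = D x"
  shows "map_pmf (\<lambda>v. (coordinate_queue N Mstar Q0 k v, cycle_data N k v)) (Pi_pmf (sources_upto N (Suc k)) 0 D)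
    = pair_pmf (map_pmf (coordinate_queue N Mstar Q0 k) (Pi_pmf (sources_upto N k) 0 D)) (cycle_pmf N D)"
proof -
  let ?A = "sources_upto N k :: ('n, 'l) source set"
  let ?J = "sources_upto N (Suc 0) :: ('n, 'l) source set"
  let ?B = "shift_source N k ` ?J"
  let ?glue = "\<lambda>(f, g) x. if x \<in> ?A then f x else g x"
  have "cycle_data N k (?glue (f, g)) = cycle_data N k g" for f g
  proof
    fix x
    have "shift_source N k x \<notin> ?A" if "x \<in> ?J"
      using sources_upto_disjoint[of N k] that by blast
    then show "cycle_data N k (?glue (f, g)) x = cycle_data N k g x"
      by (simp add: cycle_data_def)
  qed
  moreover have "coordinate_queue N Mstar Q0 k (?glue (f, g)) = coordinate_queue N Mstar Q0 k f" for f g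
    by (intro coordinate_queue_cong) auto
  ultimately have glue: "(\<lambda>v. (coordinate_queue N Mstar Q0 k v, cycle_data N k v)) (?glue fg)
      = (case fg of (f, g) \<Rightarrow> (coordinate_queue N Mstar Q0 k f, cycle_data N k g))" for fg
    by (cases fg) simp
  have "Pi_pmf (?A \<union> ?B) 0 D = map_pmf ?glue (pair_pmf (Pi_pmf ?A 0 D) (Pi_pmf ?B 0 D))"
    by (rule Pi_pmf_union) (simp_all only: finite_sources_upto finite_imageI sources_upto_disjoint)
  then have "map_pmf (\<lambda>v. (coordinate_queue N Mstar Q0 k v, cycle_data N k v)) (Pi_pmf (?A \<union> ?B) 0 D)
      = map_pmf (\<lambda>(f, g). (coordinate_queue N Mstar Q0 k f, cycle_data N k g))
          (pair_pmf (Pi_pmf ?A 0 D) (Pi_pmf ?B 0 D))"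
    by (simp only: map_pmf_comp glue)
  also have "\<dots> = pair_pmf (map_pmf (coordinate_queue N Mstar Q0 k) (Pi_pmf ?A 0 D))
      (map_pmf (cycle_data N k) (Pi_pmf ?B 0 D))"
    by (rule map_pair)
  also have "map_pmf (cycle_data N k) (Pi_pmf ?B 0 D) = cycle_pmf N D"
    unfolding cycle_pmf_def cycle_data_def[abs_def]
    by (subst map_Pi_pmf_reindex) (simp_all add: finite_sources_upto inj_on_shift_source D)
  finally show ?thesis
    by (simp only: sources_upto_Suc[of N k])
qed

lemma map_coordinate_queue:
  fixes D :: "('n::finite, 'l::finite) source \<Rightarrow> nat pmf"
  assumes D: "\<And>k x. D (shift_source N k x) = D x"
  shows "map_pmf (coordinate_queue N Mstar Q0 k) (Pi_pmf (sources_upto N k) 0 D) = queue_pmf N Mstar D Q0 k"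
proof (induction k)
  case 0
  have "coordinate_queue N Mstar Q0 0 = (\<lambda>_. Q0)" by (rule ext) simp
  then show ?case by simp
next
  case (Suc k)
  have "map_pmf (coordinate_queue N Mstar Q0 (Suc k)) (Pi_pmf (sources_upto N (Suc k)) 0 D)
     = map_pmf (\<lambda>(Q, b). coordinate_queue N Mstar Q (Suc 0) b)
        (map_pmf (\<lambda>v. (coordinate_queue N Mstar Q0 k v, cycle_data N k v)) (Pi_pmf (sources_upto N (Suc k)) 0 D))"
    unfolding map_pmf_comp prod.case by (intro map_pmf_cong refl coordinate_queue_Suc)
  also have "\<dots> = queue_pmf N Mstar D Q0 (Suc k)"
    unfolding map_queue_cycle_data[where D=D, OF D] Suc
    by (simp add: pair_pmf_def map_bind_pmf map_pmf_def[symmetric] bind_return_pmf map_pmf_comp)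
  finally show ?case .
qed

subsection \<open>Drift of the quadratic Lyapunov function\<close>

fun source_law ::
  "nat pmf \<Rightarrow> (nat \<Rightarrow> 'n \<Rightarrow> 'l \<Rightarrow> real) \<Rightarrow> ('n \<Rightarrow> real) \<Rightarrow> ('n, 'l) source \<Rightarrow> nat pmf" where
  "source_law qd c m (Query t) = qd"
| "source_law qd c m (Click q i s t) = map_pmf of_bool (bernoulli_pmf (c q i s))"
| "source_law qd c m (Requirement i k) = rounding_pmf (m i)"

lemma source_law_shift: "source_law qd c m (shift_source N k x) = source_law qd c m x"
  by (cases x) auto

section \<open>Placement matrices and rounded requirements\<close>

lemma placement_entry:
  assumes "placement_matrix A"
  shows "A $ i $ s = 0 \<or> A $ i $ s = 1"
  using assms by (auto simp: placement_matrix_def)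

lemma placement_row_eq_card:
  assumes "placement_matrix A"
  shows "(\<Sum>s\<in>UNIV. A $ i $ s) = real (card {s. A $ i $ s = 1})"
proof -
  have "(\<Sum>s\<in>UNIV. A $ i $ s) = (\<Sum>s\<in>UNIV. if A $ i $ s = 1 then 1 else 0)"
    using placement_entry[OF assms, of i] by (intro sum.cong) fastforce+
  then show ?thesis by (simp add: sum.If_cases)
qed

lemma placement_row:
  assumes "placement_matrix A"
  shows "0 \<le> (\<Sum>s\<in>UNIV. A $ i $ s)" "(\<Sum>s\<in>UNIV. A $ i $ s) \<le> 1"
  unfolding placement_row_eq_card[OF assms] using assms by (auto simp: placement_matrix_def)

lemma placement_total:
  fixes A :: "real^'l^'n"
  assumes "placement_matrix A"
  shows "(\<Sum>i\<in>UNIV. \<Sum>s\<in>UNIV. A $ i $ s) \<le> real CARD('l)"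
proof -
  have "(\<Sum>i\<in>UNIV. A $ i $ s) \<le> 1" for s
  proof -
    have "(\<Sum>i\<in>UNIV. A $ i $ s) = (\<Sum>i\<in>UNIV. if A $ i $ s = 1 then 1 else 0)"
      using placement_entry[OF assms, of _ s] by (intro sum.cong) fastforce+
    then have "(\<Sum>i\<in>UNIV. A $ i $ s) = real (card {i. A $ i $ s = 1})" by (simp add: sum.If_cases)
    then show ?thesis using assms by (simp add: placement_matrix_def)
  qed
  then have "(\<Sum>s\<in>(UNIV::'l set). \<Sum>i\<in>UNIV. A $ i $ s) \<le> (\<Sum>s\<in>(UNIV::'l set). 1)"
    by (intro sum_mono)
  then show ?thesis by (subst sum.swap) simp
qed

lemma placement_0: "placement_matrix 0"
  by (simp add: placement_matrix_def)

lemma frac_bounds: "0 \<le> x - of_int \<lfloor>x\<rfloor>" "x - of_int \<lfloor>x\<rfloor> \<le> (1::real)"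
  by linarith+

lemma finite_set_rounding_pmf: "finite (set_pmf (rounding_pmf x))"
  by (simp add: rounding_pmf_def)

lemma expectation_rounding_pmf:
  fixes g :: "nat \<Rightarrow> real"
  shows "measure_pmf.expectation (rounding_pmf x) g
    = g (nat \<lceil>x\<rceil>) * (x - of_int \<lfloor>x\<rfloor>) + g (nat \<lfloor>x\<rfloor>) * (1 - x + of_int \<lfloor>x\<rfloor>)"
  unfolding rounding_pmf_def integral_map_pmf
  using frac_bounds[of x] by (subst integral_bernoulli_pmf) (simp_all add: algebra_simps)

text \<open>For integral \<open>x\<close> ceiling and floor agree; otherwise they differ by exactly
  1, and the fractional part supplies the missing amount.\<close>

lemma expectation_rounding_pmf_id:
  assumes "0 \<le> x"
  shows "measure_pmf.expectation (rounding_pmf x) real = x"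
proof (cases "x \<in> \<int>")
  case True
  then obtain n where "x = of_int n" by (rule Ints_cases)
  then show ?thesis
    unfolding expectation_rounding_pmf using assms by simp
next
  case False
  then have "x \<noteq> of_int \<lfloor>x\<rfloor>"
    by (metis Ints_of_int)
  then have "\<lceil>x\<rceil> = \<lfloor>x\<rfloor> + 1"
    unfolding ceiling_altdef by simp
  then show ?thesis
    unfolding expectation_rounding_pmf using assms by (simp add: algebra_simps)
qed

lemma expectation_rounding_pmf_square:
  assumes "0 \<le> x"
  shows "measure_pmf.expectation (rounding_pmf x) (\<lambda>r. (real r)\<^sup>2)
    = (of_int \<lceil>x\<rceil>)\<^sup>2 * (x - of_int \<lfloor>x\<rfloor>) + (of_int \<lfloor>x\<rfloor>)\<^sup>2 * (1 - x + of_int \<lfloor>x\<rfloor>)"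
proof -
  have "real (nat \<lceil>x\<rceil>) = of_int \<lceil>x\<rceil>" "real (nat \<lfloor>x\<rfloor>) = of_int \<lfloor>x\<rfloor>"
    using assms by simp_all
  then show ?thesis
    unfolding expectation_rounding_pmf by (simp only:)
qed

text \<open>The sample space is absent: the queue chain sees the randomness only through the law
  \<open>qd\<close> of one query and the rounding laws, so the drift analysis uses pmfs
  alone.\<close>

locale ctr_model =
  fixes N nq :: nat
    and \<nu> \<epsilon> :: real
    and \<theta> :: "nat \<Rightarrow> real"
    and \<M> :: "nat \<Rightarrow> (real^'l^'n) set"
    and c :: "nat \<Rightarrow> 'n \<Rightarrow> 'l \<Rightarrow> real"
    and m :: "'n \<Rightarrow> real"
    and Mstar :: "nat \<Rightarrow> real^'n \<Rightarrow> real^'l^'n"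
    and Q0 :: "real^'n"
    and qd :: "nat pmf"
  assumes N: "N \<ge> 1"
    and \<nu>: "0 \<le> \<nu>" "\<nu> \<le> 1"
    and \<theta>: "\<And>q. q \<in> {1..nq} \<Longrightarrow> 0 \<le> \<theta> q" "(\<Sum>q=1..nq. \<theta> q) = 1"
    and placement: "\<And>q A. q \<in> {1..nq} \<Longrightarrow> A \<in> \<M> q \<Longrightarrow> placement_matrix A"
    and c: "\<And>q i s. q \<in> {1..nq} \<Longrightarrow> 0 \<le> c q i s \<and> c q i s \<le> 1"
    and m: "\<And>i. 0 \<le> m i"
    and \<epsilon>: "0 < \<epsilon>"
    and rule: "max_weight_rule nq \<M> c \<epsilon> Mstar"
    and Q0: "\<And>i. 0 \<le> Q0 $ i"
    and qd: "\<And>q. q \<in> {1..nq} \<Longrightarrow> pmf qd q = \<nu> * \<theta> q" "set_pmf qd \<subseteq> {0..nq}"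
begin

abbreviation "J p \<equiv> avg_clicks nq \<nu> \<theta> \<M> c p"
abbreviation "imp p i \<equiv> avg_impressions N nq \<nu> \<theta> \<M> p i"
abbreviation "\<beta> \<equiv> cycle_pmf N (source_law qd c m)"
abbreviation "\<mu> \<equiv> queue_pmf N Mstar (source_law qd c m) Q0"
abbreviation "nonneg Q \<equiv> (\<forall>i. 0 \<le> Q $ i)"
abbreviation "next_queue \<equiv> (\<lambda>Q. coordinate_queue N Mstar Q (Suc 0))"

text \<open>The deterministic max-weight decision as a point mass, so that it competes with other
  rules inside \<open>randomizations\<close> and the linear functionals \<open>J\<close> and
  \<open>imp\<close> apply to it.\<close>

definition choice :: "real^'n \<Rightarrow> nat \<Rightarrow> real^'l^'n \<Rightarrow> real" where
  "choice Q q A = of_bool (A = Mstar q Q)"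

definition service :: "real^'n \<Rightarrow> (('n, 'l) source \<Rightarrow> nat) \<Rightarrow> 'n \<Rightarrow> real" where
  "service Q b i = (\<Sum>t<N. \<Sum>s\<in>UNIV. shown Mstar (b (Query t)) Q $ i $ s)"

text \<open>Half a bound on the sum of squared impressions of a cycle, plus half the second moments
  of the rounded requirements.\<close>

definition \<Delta> :: real where
  "\<Delta> = 1 / 2 * (real N * (real N - 1) * (real CARD('l))\<^sup>2 + real N * real CARD('l)
           + (\<Sum>i\<in>UNIV. (of_int \<lceil>m i\<rceil>)\<^sup>2 * (m i - of_int \<lfloor>m i\<rfloor>)
                       + (of_int \<lfloor>m i\<rfloor>)\<^sup>2 * (1 - m i + of_int \<lfloor>m i\<rfloor>)))"

lemma Mstar_arg_max:
  assumes "q \<in> {1..nq}" "nonneg Q"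
  shows "Mstar q Q \<in> \<M> q"
    and "A \<in> \<M> q \<Longrightarrow> (\<Sum>i\<in>UNIV. \<Sum>s\<in>UNIV. A $ i $ s * (c q i s / \<epsilon> + Q $ i))
        \<le> (\<Sum>i\<in>UNIV. \<Sum>s\<in>UNIV. Mstar q Q $ i $ s * (c q i s / \<epsilon> + Q $ i))"
  using rule assms by (auto simp: max_weight_rule_def is_arg_max_linorder)

lemma shown_placement:
  assumes "q \<le> nq" "nonneg Q"
  shows "placement_matrix (shown Mstar q Q)"
proof (cases "q = 0")
  case False
  then have "q \<in> {1..nq}" using assms by simp
  then show ?thesis
    using placement[OF _ Mstar_arg_max(1)[OF _ assms(2)]] False by (simp add: shown_def)
qed (simp add: shown_def placement_0)

lemma finite_matrices: "q \<in> {1..nq} \<Longrightarrow> finite (\<M> q)"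
  using placement by (intro finite_subset[OF _ finite_placement_matrices]) auto

lemma choice_sum:
  assumes "q \<in> {1..nq}" "nonneg Q"
  shows "(\<Sum>A\<in>\<M> q. choice Q q A * g A) = g (Mstar q Q)"
proof -
  have "(\<Sum>A\<in>\<M> q. choice Q q A * g A) = (\<Sum>A\<in>\<M> q. if A = Mstar q Q then g A else 0)"
    by (intro sum.cong) (auto simp: choice_def)
  then show ?thesis
    using finite_matrices[OF assms(1)] Mstar_arg_max(1)[OF assms] by simp
qed

lemma finite_set_sources_pmf: "finite (set_pmf (Pi_pmf (sources_upto N k) 0 (source_law qd c m)))"
proof -
  have "finite (set_pmf (source_law qd c m x))" for x :: "('n, 'l) source"
    using finite_subset[OF qd(2)] by (cases x) (auto simp: finite_set_rounding_pmf)
  then show ?thesis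
    using finite_sources_upto by (subst set_Pi_pmf) (auto intro!: finite_PiE_dflt)
qed

lemma finite_set_cycle_pmf: "finite (set_pmf \<beta>)"
  unfolding cycle_pmf_def by (rule finite_set_sources_pmf)

lemma cycle_pmf_Query_le:
  assumes "b \<in> set_pmf \<beta>"
  shows "b (Query t) \<le> nq"
proof -
  have "b x \<in> (if x \<in> sources_upto N (Suc 0) then set_pmf (source_law qd c m x) else {0})" for x
    using assms unfolding cycle_pmf_def set_Pi_pmf[OF finite_sources_upto] by (auto simp: PiE_dflt_def)
  from this[of "Query t"] show ?thesis
    using qd(2) by (auto split: if_splits)
qed

lemma integrable_cycle_pmf [simp]: "integrable (measure_pmf \<beta>) (g :: _ \<Rightarrow> real)"
  by (rule integrable_measure_pmf_finite) (rule finite_set_cycle_pmf)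

text \<open>The condition \<open>g 0 = 0\<close> expresses that an empty slot contributes nothing,
  so only the keyword probabilities appear.\<close>

lemma expectation_Query:
  fixes g :: "nat \<Rightarrow> real"
  assumes "t < N" "g 0 = 0"
  shows "measure_pmf.expectation \<beta> (\<lambda>b. g (b (Query t))) = (\<Sum>q=1..nq. \<nu> * \<theta> q * g q)"
proof -
  have "measure_pmf.expectation \<beta> (\<lambda>b. g (b (Query t)))
      = measure_pmf.expectation (map_pmf (\<lambda>b. b (Query t)) \<beta>) g"
    by simp
  also have "map_pmf (\<lambda>b. b (Query t)) \<beta> = qd"
    unfolding cycle_pmf_def using assms by (simp add: Pi_pmf_component finite_sources_upto)
  also have "measure_pmf.expectation qd g = (\<Sum>q=1..nq. pmf qd q * g q)"
  proof -
    have "q \<in> {1..nq}" if "q \<in> set_pmf qd" "g q \<noteq> 0" for q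
      using that assms(2) qd(2) by (cases "q = 0") auto
    then show ?thesis by (subst integral_measure_pmf[of "{1..nq}"]) auto
  qed
  finally show ?thesis using qd(1) by simp
qed

lemma expectation_Requirement:
  fixes g :: "nat \<Rightarrow> real"
  shows "measure_pmf.expectation \<beta> (\<lambda>b. g (b (Requirement i 0))) = measure_pmf.expectation (rounding_pmf (m i)) g"
proof -
  have "measure_pmf.expectation \<beta> (\<lambda>b. g (b (Requirement i 0)))
      = measure_pmf.expectation (map_pmf (\<lambda>b. b (Requirement i 0)) \<beta>) g"
    by simp
  also have "map_pmf (\<lambda>b. b (Requirement i 0)) \<beta> = rounding_pmf (m i)"
    unfolding cycle_pmf_def by (simp add: Pi_pmf_component finite_sources_upto)
  finally show ?thesis .
qed

lemma next_queue_nth: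
  "next_queue Q b $ i = max (Q $ i + real (b (Requirement i 0)) - service Q b i) 0"
  by (simp add: coordinate_queue_def impressions_def service_def atLeast0LessThan)

lemma expectation_service:
  assumes "nonneg Q"
  shows "measure_pmf.expectation \<beta> (\<lambda>b. service Q b i) = imp (choice Q) i"
proof -
  have "measure_pmf.expectation \<beta> (\<lambda>b. service Q b i)
     = (\<Sum>t<N. measure_pmf.expectation \<beta> (\<lambda>b. \<Sum>s\<in>UNIV. shown Mstar (b (Query t)) Q $ i $ s))"
    unfolding service_def by (rule Bochner_Integration.integral_sum) simp
  also have "\<dots> = (\<Sum>t<N. \<Sum>q=1..nq. \<nu> * \<theta> q * (\<Sum>s\<in>UNIV. shown Mstar q Q $ i $ s))"
    by (intro sum.cong refl expectation_Query[where g="\<lambda>q. \<Sum>s\<in>UNIV. shown Mstar q Q $ i $ s"])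
      (auto simp: shown_def)
  also have "\<dots> = imp (choice Q) i"
    unfolding avg_impressions_def using assms
    by (simp add: choice_sum shown_def)
  finally show ?thesis .
qed

lemma service_bounds:
  assumes "nonneg Q" "b \<in> set_pmf \<beta>"
  shows "0 \<le> service Q b i" "service Q b i \<le> real N"
    and "(\<Sum>i\<in>UNIV. service Q b i) \<le> real N * real CARD('l)"
proof -
  have pl: "placement_matrix (shown Mstar (b (Query t)) Q)" for t
    using assms by (intro shown_placement cycle_pmf_Query_le)
  show "0 \<le> service Q b i"
    unfolding service_def by (intro sum_nonneg placement_row(1) pl)
  have "service Q b i \<le> (\<Sum>t<N. 1)"
    unfolding service_def by (intro sum_mono placement_row(2) pl)
  then show "service Q b i \<le> real N" by simp
  have "(\<Sum>t<N. \<Sum>i\<in>UNIV. \<Sum>s\<in>UNIV. shown Mstar (b (Query t)) Q $ i $ s) \<le> (\<Sum>t<N. real CARD('l))"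
    by (intro sum_mono placement_total pl)
  then show "(\<Sum>i\<in>UNIV. service Q b i) \<le> real N * real CARD('l)"
    unfolding service_def by (subst sum.swap) simp
qed

text \<open>A client gets at most \<open>N\<close> impressions per cycle and all clients together at
  most \<open>N * L\<close>, so the squares sum to at most
  \<open>N * N * L = N * (N - 1) * L + N * L\<close>. Replacing \<open>L\<close> by its square in
  the first term gives the form found in \<open>\<Delta>\<close>.\<close>

lemma sum_service_square_le:
  assumes "nonneg Q" "b \<in> set_pmf \<beta>"
  shows "(\<Sum>i\<in>UNIV. (service Q b i)\<^sup>2) \<le> real N * (real N - 1) * (real CARD('l))\<^sup>2 + real N * real CARD('l)"
proof -
  have L: "real CARD('l) \<le> (real CARD('l))\<^sup>2"
    using self_le_power[of "real CARD('l)" 2] by (simp add: Suc_leI)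
  have "(\<Sum>i\<in>UNIV. (service Q b i)\<^sup>2) \<le> (\<Sum>i\<in>UNIV. real N * service Q b i)"
    unfolding power2_eq_square by (intro sum_mono mult_right_mono service_bounds assms)
  also have "\<dots> \<le> real N * (real N * real CARD('l))"
    unfolding sum_distrib_left[symmetric] by (intro mult_left_mono service_bounds assms) simp
  also have "\<dots> = real N * (real N - 1) * real CARD('l) + real N * real CARD('l)"
    by (simp add: algebra_simps)
  also have "\<dots> \<le> real N * (real N - 1) * (real CARD('l))\<^sup>2 + real N * real CARD('l)"
    using L N by (intro add_right_mono mult_left_mono) auto
  finally show ?thesis .
qed

definition V :: "real^'n \<Rightarrow> real" where
  "V Q = 1 / 2 * (\<Sum>i\<in>UNIV. (Q $ i)\<^sup>2)"

text \<open>Truncation at 0 can only shrink the square. After expansion the cross term of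
  requirement and service is nonpositive and is dropped.\<close>

lemma V_next_le:
  assumes "nonneg Q" "b \<in> set_pmf \<beta>"
  shows "V (next_queue Q b) \<le> V Q
    + 1 / 2 * (real N * (real N - 1) * (real CARD('l))\<^sup>2 + real N * real CARD('l))
    + (\<Sum>i\<in>UNIV. Q $ i * (real (b (Requirement i 0)) - service Q b i) + 1 / 2 * (real (b (Requirement i 0)))\<^sup>2)"
proof -
  let ?r = "\<lambda>i. real (b (Requirement i 0))"
  have "(next_queue Q b $ i)\<^sup>2 \<le> (Q $ i)\<^sup>2 + (service Q b i)\<^sup>2
      + 2 * (Q $ i * (?r i - service Q b i) + 1 / 2 * (?r i)\<^sup>2)" for i
  proof -
    have "(next_queue Q b $ i)\<^sup>2 \<le> (Q $ i + ?r i - service Q b i)\<^sup>2"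
      unfolding next_queue_nth by (simp add: max_def)
    also have "\<dots> = (Q $ i)\<^sup>2 + (service Q b i)\<^sup>2
      + 2 * (Q $ i * (?r i - service Q b i) + 1 / 2 * (?r i)\<^sup>2) - 2 * (?r i * service Q b i)"
      by (simp add: power2_eq_square algebra_simps)
    finally show ?thesis
      using mult_nonneg_nonneg[OF of_nat_0_le_iff service_bounds(1)[OF assms], of "b (Requirement i 0)" i]
      by linarith
  qed
  then have "(\<Sum>i\<in>UNIV. (next_queue Q b $ i)\<^sup>2) \<le> (\<Sum>i\<in>UNIV. (Q $ i)\<^sup>2 + (service Q b i)\<^sup>2
      + 2 * (Q $ i * (?r i - service Q b i) + 1 / 2 * (?r i)\<^sup>2))"
    by (intro sum_mono)
  also have "\<dots> = (\<Sum>i\<in>UNIV. (Q $ i)\<^sup>2) + (\<Sum>i\<in>UNIV. (service Q b i)\<^sup>2)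
      + 2 * (\<Sum>i\<in>UNIV. Q $ i * (?r i - service Q b i) + 1 / 2 * (?r i)\<^sup>2)"
    by (simp add: sum.distrib sum_distrib_left)
  finally have "(\<Sum>i\<in>UNIV. (next_queue Q b $ i)\<^sup>2) \<le> \<dots>" .
  moreover have "1 / 2 * x \<le> 1 / 2 * y + 1 / 2 * C + z" if "x \<le> y + s + 2 * z" "s \<le> C" for x y z s C :: real
    using that by linarith
  ultimately show ?thesis
    using sum_service_square_le[OF assms] unfolding V_def by blast
qed

text \<open>For fixed \<open>Q\<close> the term linear in the queues needs only the means of
  requirement and service; the bounds on the quadratic terms are free of \<open>Q\<close> and make
  up \<open>\<Delta>\<close>.\<close>

lemma expected_drift:
  assumes "nonneg Q"
  shows "measure_pmf.expectation \<beta> (\<lambda>b. V (next_queue Q b))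
    \<le> V Q + \<Delta> + (\<Sum>i\<in>UNIV. Q $ i * (m i - imp (choice Q) i))"
proof -
  let ?r = "\<lambda>i b. real (b (Requirement i 0))"
  let ?C = "1 / 2 * (real N * (real N - 1) * (real CARD('l))\<^sup>2 + real N * real CARD('l))"
  have r1: "measure_pmf.expectation \<beta> (?r i) = m i" for i
    using expectation_Requirement[of real i] expectation_rounding_pmf_id[OF m] by simp
  have r2: "measure_pmf.expectation \<beta> (\<lambda>b. (?r i b)\<^sup>2)
      = (of_int \<lceil>m i\<rceil>)\<^sup>2 * (m i - of_int \<lfloor>m i\<rfloor>) + (of_int \<lfloor>m i\<rfloor>)\<^sup>2 * (1 - m i + of_int \<lfloor>m i\<rfloor>)" for i
    using expectation_Requirement[of "\<lambda>r. (real r)\<^sup>2" i] expectation_rounding_pmf_square[OF m] by simp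
  have "measure_pmf.expectation \<beta> (\<lambda>b. V (next_queue Q b)) \<le> measure_pmf.expectation \<beta> (\<lambda>b. V Q + ?C
      + (\<Sum>i\<in>UNIV. Q $ i * (?r i b - service Q b i) + 1 / 2 * (?r i b)\<^sup>2))"
    using V_next_le[OF assms] by (intro integral_mono_AE AE_pmfI integrable_cycle_pmf)
  also have "\<dots> = V Q + ?C + (\<Sum>i\<in>UNIV. measure_pmf.expectation \<beta>
      (\<lambda>b. Q $ i * (?r i b - service Q b i) + 1 / 2 * (?r i b)\<^sup>2))"
    by (simp add: Bochner_Integration.integral_sum)
  also have "(\<Sum>i\<in>UNIV. measure_pmf.expectation \<beta> (\<lambda>b. Q $ i * (?r i b - service Q b i) + 1 / 2 * (?r i b)\<^sup>2))
     = (\<Sum>i\<in>UNIV. Q $ i * (m i - imp (choice Q) i) + 1 / 2 * ((of_int \<lceil>m i\<rceil>)\<^sup>2 * (m i - of_int \<lfloor>m i\<rfloor>)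
          + (of_int \<lfloor>m i\<rfloor>)\<^sup>2 * (1 - m i + of_int \<lfloor>m i\<rfloor>)))"
  proof (intro sum.cong refl)
    fix i
    have "measure_pmf.expectation \<beta> (\<lambda>b. Q $ i * (?r i b - service Q b i) + 1 / 2 * (?r i b)\<^sup>2)
      = Q $ i * (measure_pmf.expectation \<beta> (?r i) - measure_pmf.expectation \<beta> (\<lambda>b. service Q b i))
        + 1 / 2 * measure_pmf.expectation \<beta> (\<lambda>b. (?r i b)\<^sup>2)"
      by (simp only: Bochner_Integration.integral_add Bochner_Integration.integral_diff integral_mult_right_zero integrable_cycle_pmf)
    then show "measure_pmf.expectation \<beta> (\<lambda>b. Q $ i * (?r i b - service Q b i) + 1 / 2 * (?r i b)\<^sup>2)
      = Q $ i * (m i - imp (choice Q) i) + 1 / 2 * ((of_int \<lceil>m i\<rceil>)\<^sup>2 * (m i - of_int \<lfloor>m i\<rfloor>)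
          + (of_int \<lfloor>m i\<rfloor>)\<^sup>2 * (1 - m i + of_int \<lfloor>m i\<rfloor>))"
      unfolding r1 r2 expectation_service[OF assms] .
  qed
  also have "V Q + ?C + \<dots> = V Q + \<Delta> + (\<Sum>i\<in>UNIV. Q $ i * (m i - imp (choice Q) i))"
    unfolding \<Delta>_def sum.distrib[of "\<lambda>i. Q $ i * (m i - imp (choice Q) i)"] sum_distrib_left[symmetric]
    by (simp add: algebra_simps)
  finally show ?thesis by linarith
qed

text \<open>Scaling the clicks by \<open>N / \<epsilon>\<close> produces exactly the objective of
  the max-weight rule, and the sum then separates over keywords.\<close>

lemma weight_eq:
  "(\<Sum>i\<in>UNIV. Q $ i * imp p i) + real N / \<epsilon> * J p
    = real N * (\<Sum>q=1..nq. \<nu> * \<theta> q * (\<Sum>A\<in>\<M> q. p q A *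
        (\<Sum>i\<in>UNIV. \<Sum>s\<in>UNIV. A $ i $ s * (c q i s / \<epsilon> + Q $ i))))"
proof -
  have "(\<Sum>i\<in>UNIV. Q $ i * imp p i)
      = real N * (\<Sum>q=1..nq. \<nu> * \<theta> q * (\<Sum>A\<in>\<M> q. p q A * (\<Sum>i\<in>UNIV. \<Sum>s\<in>UNIV. A $ i $ s * Q $ i)))"
    unfolding avg_impressions_def sum_distrib_left
    by (subst sum.swap, intro sum.cong refl, subst sum.swap, intro sum.cong refl) (simp add: mult_ac)
  moreover have "real N / \<epsilon> * J p
      = real N * (\<Sum>q=1..nq. \<nu> * \<theta> q * (\<Sum>A\<in>\<M> q. p q A * (\<Sum>i\<in>UNIV. \<Sum>s\<in>UNIV. A $ i $ s * (c q i s / \<epsilon>))))"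
    unfolding avg_clicks_def sum_distrib_left by (intro sum.cong refl) (simp add: mult_ac)
  ultimately show ?thesis
    by (simp add: distrib_left sum.distrib)
qed

text \<open>For each keyword \<open>p\<close> yields at most its total mass times the maximal
  weight. That mass may be below 1, so nonnegativity of the maximal weight is used to raise it to
  1.\<close>

lemma choice_maximizes_weight:
  assumes "p \<in> randomizations nq \<M>" "nonneg Q"
  shows "(\<Sum>i\<in>UNIV. Q $ i * imp p i) + real N / \<epsilon> * J p
    \<le> (\<Sum>i\<in>UNIV. Q $ i * imp (choice Q) i) + real N / \<epsilon> * J (choice Q)"
  unfolding weight_eq
proof (rule mult_left_mono[OF sum_mono[OF mult_left_mono]])
  fix q assume q: "q \<in> {1..nq}"
  let ?w = "\<lambda>A. \<Sum>i\<in>UNIV. \<Sum>s\<in>UNIV. A $ i $ s * (c q i s / \<epsilon> + Q $ i)"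
  have "0 \<le> ?w (Mstar q Q)"
    using placement_entry[OF placement[OF q Mstar_arg_max(1)[OF q assms(2)]]] c[OF q] \<epsilon> assms(2)
    by (intro sum_nonneg mult_nonneg_nonneg add_nonneg_nonneg divide_nonneg_pos) (auto, metis order_refl zero_le_one)
  have "(\<Sum>A\<in>\<M> q. p q A * ?w A) \<le> (\<Sum>A\<in>\<M> q. p q A * ?w (Mstar q Q))"
    using assms(1) q by (intro sum_mono[OF mult_left_mono[OF Mstar_arg_max(2)[OF q assms(2)]]])
      (auto simp: randomizations_def)
  also have "\<dots> = (\<Sum>A\<in>\<M> q. p q A) * ?w (Mstar q Q)"
    by (rule sum_distrib_right[symmetric])
  also have "\<dots> \<le> 1 * ?w (Mstar q Q)"
    using assms(1) q by (intro mult_right_mono \<open>0 \<le> ?w (Mstar q Q)\<close>) (auto simp: randomizations_def)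
  also have "\<dots> = (\<Sum>A\<in>\<M> q. choice Q q A * ?w A)"
    unfolding choice_sum[OF q assms(2), of ?w] by simp
  finally show "(\<Sum>A\<in>\<M> q. p q A * ?w A) \<le> (\<Sum>A\<in>\<M> q. choice Q q A * ?w A)" .
next
  show "0 \<le> \<nu> * \<theta> q" if "q \<in> {1..nq}" for q
    using \<nu> \<theta>(1)[OF that] by simp
qed simp

end

text \<open>A queue coordinate stays in the integer translate of its initial value until it is first
  truncated at 0 and is an integer from then on; hence the two cosets.\<close>

lemma finite_bounded_lattice_points:
  "finite {Q :: real^'n. \<forall>i. (Q $ i \<in> \<int> \<or> Q $ i - P $ i \<in> \<int>) \<and> 0 \<le> Q $ i \<and> Q $ i \<le> R}"
proof -
  let ?X = "\<lambda>i. {x \<in> \<int>. 0 \<le> x \<and> x \<le> R} \<union> (\<lambda>z. z + P $ i) ` {z \<in> \<int>. - P $ i \<le> z \<and> z \<le> R - P $ i}"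
  have "finite (PiE UNIV ?X)"
    by (intro finite_PiE finite_UnI finite_imageI finite_int_segment) simp
  moreover have "{Q :: real^'n. \<forall>i. (Q $ i \<in> \<int> \<or> Q $ i - P $ i \<in> \<int>) \<and> 0 \<le> Q $ i \<and> Q $ i \<le> R}
      \<subseteq> (\<lambda>f. \<chi> i. f i) ` PiE UNIV ?X"
  proof
    fix Q :: "real^'n"
    assume Q: "Q \<in> {Q. \<forall>i. (Q $ i \<in> \<int> \<or> Q $ i - P $ i \<in> \<int>) \<and> 0 \<le> Q $ i \<and> Q $ i \<le> R}"
    have "Q $ i \<in> ?X i" for i
    proof (cases "Q $ i \<in> \<int>")
      case False
      then have "Q $ i - P $ i \<in> {z \<in> \<int>. - P $ i \<le> z \<and> z \<le> R - P $ i}"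
        using Q by auto
      then have "Q $ i \<in> (\<lambda>z. z + P $ i) ` {z \<in> \<int>. - P $ i \<le> z \<and> z \<le> R - P $ i}"
        by (rule rev_image_eqI) simp
      then show ?thesis by (rule UnI2)
    qed (use Q in auto)
    then show "Q \<in> (\<lambda>f. \<chi> i. f i) ` PiE UNIV ?X"
      by (intro image_eqI[of _ _ "\<lambda>i. Q $ i"]) auto
  qed
  ultimately show ?thesis by (rule finite_subset[rotated, OF finite_imageI])
qed

lemma avg_clicks_linear:
  "avg_clicks nq \<nu> \<theta> \<M> c (\<lambda>q A. x * p q A + y * p' q A)
     = x * avg_clicks nq \<nu> \<theta> \<M> c p + y * avg_clicks nq \<nu> \<theta> \<M> c p'"
  unfolding avg_clicks_def
  by (simp add: distrib_right sum.distrib sum_distrib_left distrib_left mult_ac)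

lemma avg_impressions_linear:
  "avg_impressions N nq \<nu> \<theta> \<M> (\<lambda>q A. x * p q A + y * p' q A) i
     = x * avg_impressions N nq \<nu> \<theta> \<M> p i + y * avg_impressions N nq \<nu> \<theta> \<M> p' i"
  unfolding avg_impressions_def
  by (simp add: distrib_right sum.distrib sum_distrib_left distrib_left mult_ac)

lemma randomizations_convex:
  assumes p: "p \<in> randomizations nq \<M>" "p' \<in> randomizations nq \<M>" and x: "0 \<le> x" "0 \<le> y" "x + y = 1"
  shows "(\<lambda>q A. x * p q A + y * p' q A) \<in> randomizations nq \<M>"
  unfolding randomizations_def
proof (intro CollectI ballI conjI)
  fix q A assume q: "q \<in> {1..nq}" "A \<in> \<M> q"
  then have pq: "0 \<le> p q A" "p q A \<le> 1" "0 \<le> p' q A" "p' q A \<le> 1"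
    using p by (auto simp: randomizations_def)
  then show "0 \<le> x * p q A + y * p' q A" using x by simp
  show "x * p q A + y * p' q A \<le> 1" by (rule convex_bound_le) (use pq x in auto)
next
  fix q assume q: "q \<in> {1..nq}"
  have "x * (\<Sum>A\<in>\<M> q. p q A) + y * (\<Sum>A\<in>\<M> q. p' q A) \<le> 1"
    by (rule convex_bound_le) (use p q x in \<open>auto simp: randomizations_def\<close>)
  then show "(\<Sum>A\<in>\<M> q. x * p q A + y * p' q A) \<le> 1"
    by (simp add: sum.distrib sum_distrib_left)
qed

section \<open>Expectations along the queue chain\<close>

context ctr_model
begin

text \<open>This makes every function integrable at each fixed time. The supports may still grow
  with \<open>k\<close>, so tightness has to come from the drift.\<close>

lemma finite_set_queue_pmf: "finite (set_pmf (\<mu> k))"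
  by (induction k) (auto simp: finite_set_cycle_pmf)

lemma integrable_queue_pmf [simp]: "integrable (measure_pmf (\<mu> k)) (g :: _ \<Rightarrow> real)"
  by (rule integrable_measure_pmf_finite) (rule finite_set_queue_pmf)

lemma queue_pmf_nonneg: "Q \<in> set_pmf (\<mu> k) \<Longrightarrow> nonneg Q"
  using Q0 by (cases k) (auto simp: next_queue_nth)

lemma service_Ints:
  assumes "nonneg Q" "b \<in> set_pmf \<beta>"
  shows "service Q b i \<in> \<int>"
proof -
  have "shown Mstar (b (Query t)) Q $ i $ s \<in> \<int>" for t s
    using placement_entry[OF shown_placement[OF cycle_pmf_Query_le[OF assms(2)] assms(1)], of t i s] by auto
  then show ?thesis unfolding service_def by (intro Ints_sum)
qed

lemma queue_pmf_lattice:
  assumes "Q \<in> set_pmf (\<mu> k)"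
  shows "Q $ i \<in> \<int> \<or> Q $ i - Q0 $ i \<in> \<int>"
  using assms
proof (induction k arbitrary: Q)
  case (Suc k)
  then obtain R b where R: "R \<in> set_pmf (\<mu> k)" and b: "b \<in> set_pmf \<beta>" and Q: "Q = next_queue R b"
    by auto
  have z: "real (b (Requirement i 0)) - service R b i \<in> \<int>"
    by (intro Ints_diff service_Ints queue_pmf_nonneg[OF R] b) auto
  consider "Q $ i = 0" | "Q $ i = R $ i + (real (b (Requirement i 0)) - service R b i)"
    unfolding Q next_queue_nth by linarith
  then show ?case
  proof cases
    case 2
    then have "Q $ i - Q0 $ i = R $ i - Q0 $ i + (real (b (Requirement i 0)) - service R b i)" by simp
    with 2 show ?thesis using Suc.IH[OF R] Ints_add[OF _ z] by metis
  qed simp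
qed simp

lemma expectation_queue_Suc:
  fixes g :: "real^'n \<Rightarrow> real"
  shows "measure_pmf.expectation (\<mu> (Suc k)) g
    = measure_pmf.expectation (\<mu> k) (\<lambda>Q. measure_pmf.expectation \<beta> (\<lambda>b. g (next_queue Q b)))"
  by (simp add: expectation_bind_pmf_finite finite_set_queue_pmf finite_set_cycle_pmf)

definition mean_V :: "nat \<Rightarrow> real" where "mean_V k = measure_pmf.expectation (\<mu> k) V"
definition mean_queue :: "nat \<Rightarrow> 'n \<Rightarrow> real" where
  "mean_queue k i = measure_pmf.expectation (\<mu> k) (\<lambda>Q. Q $ i)"
definition mean_J :: "nat \<Rightarrow> real" where
  "mean_J k = measure_pmf.expectation (\<mu> k) (\<lambda>Q. J (choice Q))"
definition mean_imp :: "nat \<Rightarrow> 'n \<Rightarrow> real" where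
  "mean_imp k i = measure_pmf.expectation (\<mu> k) (\<lambda>Q. imp (choice Q) i)"

text \<open>The click term is what allows the max-weight choice to be replaced by \<open>p\<close>.
  Since \<open>p\<close> does not depend on the queue, the remaining sum is linear in
  \<open>Q\<close> and averages to the mean queues.\<close>

lemma mean_V_Suc_le:
  assumes p: "p \<in> randomizations nq \<M>"
  shows "mean_V (Suc k) \<le> mean_V k + \<Delta> + (\<Sum>i\<in>UNIV. mean_queue k i * (m i - imp p i)) + real N / \<epsilon> * (mean_J k - J p)"
proof -
  have "mean_V (Suc k) \<le> measure_pmf.expectation (\<mu> k) (\<lambda>Q. V Q + \<Delta> +
      (\<Sum>i\<in>UNIV. Q $ i * (m i - imp p i)) + real N / \<epsilon> * (J (choice Q) - J p))"
    unfolding mean_V_def expectation_queue_Suc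
  proof (intro integral_mono_AE AE_pmfI integrable_queue_pmf)
    fix Q assume "Q \<in> set_pmf (\<mu> k)"
    then have Q: "nonneg Q" by (rule queue_pmf_nonneg)
    show "measure_pmf.expectation \<beta> (\<lambda>b. V (next_queue Q b)) \<le> V Q + \<Delta> +
      (\<Sum>i\<in>UNIV. Q $ i * (m i - imp p i)) + real N / \<epsilon> * (J (choice Q) - J p)"
      using expected_drift[OF Q] choice_maximizes_weight[OF p Q]
      by (simp add: right_diff_distrib sum_subtractf)
  qed
  also have "\<dots> = mean_V k + \<Delta> + (\<Sum>i\<in>UNIV. mean_queue k i * (m i - imp p i)) + real N / \<epsilon> * (mean_J k - J p)"
    unfolding mean_V_def mean_queue_def mean_J_def
    by (simp add: Bochner_Integration.integral_sum)
  finally show ?thesis .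
qed

lemma mean_queue_Suc_ge: "mean_queue k i + m i - mean_imp k i \<le> mean_queue (Suc k) i"
proof -
  have "mean_queue k i + m i - mean_imp k i
      = measure_pmf.expectation (\<mu> k) (\<lambda>Q. Q $ i + m i - imp (choice Q) i)"
    by (simp add: mean_queue_def mean_imp_def)
  also have "\<dots> \<le> mean_queue (Suc k) i"
    unfolding mean_queue_def expectation_queue_Suc
  proof (intro integral_mono_AE AE_pmfI integrable_queue_pmf)
    fix Q assume "Q \<in> set_pmf (\<mu> k)"
    then have Q: "nonneg Q" by (rule queue_pmf_nonneg)
    have "Q $ i + m i - imp (choice Q) i
        = measure_pmf.expectation \<beta> (\<lambda>b. Q $ i + real (b (Requirement i 0)) - service Q b i)"
      using expectation_Requirement[of real i] expectation_rounding_pmf_id[OF m, of i] expectation_service[OF Q, of i]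
      by simp
    also have "\<dots> \<le> measure_pmf.expectation \<beta> (\<lambda>b. next_queue Q b $ i)"
      by (intro integral_mono integrable_cycle_pmf) (simp add: next_queue_nth)
    finally show "Q $ i + m i - imp (choice Q) i \<le> measure_pmf.expectation \<beta> (\<lambda>b. next_queue Q b $ i)" .
  qed
  finally show ?thesis .
qed

text \<open>The crude upper bound suffices: it affects stability constants and vanishing error
  terms, never \<open>\<Delta>\<close>.\<close>

lemma J_bounds:
  assumes p: "p \<in> randomizations nq \<M>"
  shows "0 \<le> J p" "J p \<le> (real CARD('n) * real CARD('l))"
proof -
  have r: "0 \<le> (\<Sum>i\<in>UNIV. \<Sum>s\<in>UNIV. A $ i $ s * c q i s)"
    "(\<Sum>i\<in>UNIV. \<Sum>s\<in>UNIV. A $ i $ s * c q i s) \<le> (real CARD('n) * real CARD('l))"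
    if q: "q \<in> {1..nq}" "A \<in> \<M> q" for q A
  proof -
    have e: "0 \<le> A $ i $ s * c q i s \<and> A $ i $ s * c q i s \<le> 1" for i s
      using placement_entry[OF placement[OF q], of i s] c[OF q(1), of i s] by auto
    then show "0 \<le> (\<Sum>i\<in>UNIV. \<Sum>s\<in>UNIV. A $ i $ s * c q i s)"
      by (intro sum_nonneg) simp
    have "(\<Sum>i\<in>UNIV. \<Sum>s\<in>UNIV. A $ i $ s * c q i s) \<le> (\<Sum>i\<in>(UNIV::'n set). \<Sum>s\<in>(UNIV::'l set). 1)"
      using e by (intro sum_mono) simp
    then show "(\<Sum>i\<in>UNIV. \<Sum>s\<in>UNIV. A $ i $ s * c q i s) \<le> (real CARD('n) * real CARD('l))" by simp
  qed
  have \<nu>\<theta>: "0 \<le> \<nu> * \<theta> q" if "q \<in> {1..nq}" for q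
    using \<nu> \<theta>(1)[OF that] by simp
  show "0 \<le> J p"
    unfolding avg_clicks_def using p
    by (intro sum_nonneg mult_nonneg_nonneg \<nu>\<theta> r) (auto simp: randomizations_def)
  have "J p \<le> (\<Sum>q=1..nq. \<nu> * \<theta> q * (real CARD('n) * real CARD('l)))"
    unfolding avg_clicks_def
  proof (intro sum_mono mult_left_mono \<nu>\<theta>)
    fix q assume q: "q \<in> {1..nq}"
    have "(\<Sum>A\<in>\<M> q. p q A * (\<Sum>i\<in>UNIV. \<Sum>s\<in>UNIV. A $ i $ s * c q i s)) \<le> (\<Sum>A\<in>\<M> q. p q A * (real CARD('n) * real CARD('l)))"
      using p q by (intro sum_mono mult_left_mono r) (auto simp: randomizations_def)
    also have "\<dots> = (\<Sum>A\<in>\<M> q. p q A) * (real CARD('n) * real CARD('l))" by (rule sum_distrib_right[symmetric])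
    also have "\<dots> \<le> 1 * (real CARD('n) * real CARD('l))"
      using p q by (intro mult_right_mono) (auto simp: randomizations_def)
    finally show "(\<Sum>A\<in>\<M> q. p q A * (\<Sum>i\<in>UNIV. \<Sum>s\<in>UNIV. A $ i $ s * c q i s)) \<le> (real CARD('n) * real CARD('l))" by simp
  qed
  also have "\<dots> = \<nu> * (\<Sum>q=1..nq. \<theta> q) * (real CARD('n) * real CARD('l))"
    by (simp add: sum_distrib_left sum_distrib_right)
  also have "\<dots> \<le> (real CARD('n) * real CARD('l))"
    using \<nu> \<theta>(2) by (simp add: mult_left_le_one_le)
  finally show "J p \<le> (real CARD('n) * real CARD('l))" .
qed

lemma choice_randomization: "nonneg Q \<Longrightarrow> choice Q \<in> randomizations nq \<M>"
  using choice_sum[of _ Q "\<lambda>_. 1"] by (auto simp: randomizations_def choice_def)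

lemma mean_J_bounds: "0 \<le> mean_J k" "mean_J k \<le> (real CARD('n) * real CARD('l))"
proof -
  have b: "0 \<le> J (choice Q)" "J (choice Q) \<le> (real CARD('n) * real CARD('l))" if "Q \<in> set_pmf (\<mu> k)" for Q
    using J_bounds[OF choice_randomization[OF queue_pmf_nonneg[OF that]]] by auto
  show "0 \<le> mean_J k"
    unfolding mean_J_def by (intro integral_nonneg_AE AE_pmfI b)
  have "mean_J k \<le> measure_pmf.expectation (\<mu> k) (\<lambda>_. (real CARD('n) * real CARD('l)))"
    unfolding mean_J_def by (intro integral_mono_AE AE_pmfI b integrable_queue_pmf)
  then show "mean_J k \<le> (real CARD('n) * real CARD('l))" by simp
qed

lemma mean_queue_nonneg: "0 \<le> mean_queue k i"
  unfolding mean_queue_def using queue_pmf_nonneg by (intro integral_nonneg_AE AE_pmfI) auto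

lemma mean_V_nonneg: "0 \<le> mean_V k"
  unfolding mean_V_def V_def by (intro integral_nonneg_AE AE_pmfI) (auto intro: sum_nonneg)

text \<open>Nonnegativity of the variance, followed by bounding one square by the sum in
  \<open>V\<close>.\<close>

lemma mean_queue_le_sqrt: "mean_queue k i \<le> sqrt (2 * mean_V k)"
proof (rule real_le_rsqrt)
  have "(mean_queue k i)\<^sup>2 \<le> measure_pmf.expectation (\<mu> k) (\<lambda>Q. (Q $ i)\<^sup>2)"
  proof -
    have "0 \<le> measure_pmf.expectation (\<mu> k) (\<lambda>Q. (Q $ i - mean_queue k i)\<^sup>2)"
      by (intro integral_nonneg_AE AE_pmfI) simp
    also have "\<dots> = measure_pmf.expectation (\<mu> k) (\<lambda>Q. (Q $ i)\<^sup>2 - 2 * mean_queue k i * Q $ i + (mean_queue k i)\<^sup>2)"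
      by (intro integral_cong_AE AE_pmfI) (simp_all add: power2_eq_square algebra_simps)
    also have "\<dots> = measure_pmf.expectation (\<mu> k) (\<lambda>Q. (Q $ i)\<^sup>2) - 2 * mean_queue k i * mean_queue k i + (mean_queue k i)\<^sup>2"
      by (simp add: mean_queue_def)
    finally show ?thesis by (simp add: power2_eq_square)
  qed
  also have "\<dots> \<le> measure_pmf.expectation (\<mu> k) (\<lambda>Q. 2 * V Q)"
  proof (intro integral_mono integrable_queue_pmf)
    fix Q :: "real^'n"
    have "(Q $ i)\<^sup>2 \<le> (\<Sum>i\<in>UNIV. (Q $ i)\<^sup>2)" by (rule member_le_sum) auto
    then show "(Q $ i)\<^sup>2 \<le> 2 * V Q" by (simp add: V_def)
  qed
  also have "\<dots> = 2 * mean_V k" by (simp add: mean_V_def)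
  finally show "(mean_queue k i)\<^sup>2 \<le> 2 * mean_V k" .
qed

text \<open>For feasible \<open>p\<close> the queue term of the drift is nonpositive. Summation
  telescopes \<open>mean_V\<close>, and division by \<open>K * N / \<epsilon>\<close> leaves the
  constant plus a fading effect of the initial queue.\<close>

lemma clicks_gap_upper:
  assumes p: "p \<in> feasible N nq \<nu> \<theta> \<M> m" and K: "K > 0"
  shows "J p - (\<Sum>k<K. mean_J k) / real K \<le> \<Delta> * \<epsilon> / real N + \<epsilon> * mean_V 0 / real N / real K"
proof -
  have "mean_V k + (\<Sum>j<k. real N / \<epsilon> * (J p - mean_J j)) \<le> mean_V 0 + real k * \<Delta>" for k
  proof (induction k)
    case (Suc k)
    have "(\<Sum>i\<in>UNIV. mean_queue k i * (m i - imp p i)) \<le> 0"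
      using p mean_queue_nonneg by (intro sum_nonpos mult_nonneg_nonpos) (auto simp: feasible_def)
    moreover have "mean_V (Suc k) \<le> mean_V k + \<Delta> + (\<Sum>i\<in>UNIV. mean_queue k i * (m i - imp p i))
        + real N / \<epsilon> * (mean_J k - J p)"
      using p by (intro mean_V_Suc_le) (simp add: feasible_def)
    moreover have "real N / \<epsilon> * (mean_J k - J p) = - (real N / \<epsilon> * (J p - mean_J k))"
      by (simp add: algebra_simps)
    moreover have "real (Suc k) * \<Delta> = real k * \<Delta> + \<Delta>" by (simp add: algebra_simps)
    ultimately show ?case using Suc by simp
  qed simp
  from this[of K] have "real N / \<epsilon> * (real K * J p - (\<Sum>k<K. mean_J k)) \<le> mean_V 0 + real K * \<Delta>"
    using mean_V_nonneg[of K] unfolding sum_distrib_left[symmetric] sum_subtractf by simp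
  then have "real K * J p - (\<Sum>k<K. mean_J k) \<le> \<epsilon> / real N * (mean_V 0 + real K * \<Delta>)"
    using \<epsilon> N by (simp add: field_simps)
  then have "(real K * J p - (\<Sum>k<K. mean_J k)) / real K \<le> \<epsilon> / real N * (mean_V 0 + real K * \<Delta>) / real K"
    by (rule divide_right_mono) simp
  moreover have "(real K * J p - (\<Sum>k<K. mean_J k)) / real K = J p - (\<Sum>k<K. mean_J k) / real K"
    using K by (simp add: diff_divide_distrib)
  moreover have "\<epsilon> / real N * (mean_V 0 + real K * \<Delta>) / real K
      = \<Delta> * \<epsilon> / real N + \<epsilon> * mean_V 0 / real N / real K"
    using K by (simp add: add_divide_distrib distrib_left)
  ultimately show ?thesis by linarith
qed

text \<open>By linearity the time-averaged clicks and impressions of the algorithm are the values of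
  this single randomization, which can then be compared with \<open>pstar\<close>.\<close>

definition time_share :: "nat \<Rightarrow> nat \<Rightarrow> real^'l^'n \<Rightarrow> real" where
  "time_share K q A = (\<Sum>k<K. measure_pmf.expectation (\<mu> k) (\<lambda>Q. choice Q q A)) / real K"

lemma J_time_share: "J (time_share K) = (\<Sum>k<K. mean_J k) / real K"
proof -
  have "mean_J k = J (\<lambda>q A. measure_pmf.expectation (\<mu> k) (\<lambda>Q. choice Q q A))" for k
    unfolding mean_J_def avg_clicks_def by (simp add: Bochner_Integration.integral_sum)
  then have "(\<Sum>k<K. mean_J k) / real K
      = (\<Sum>k<K. J (\<lambda>q A. measure_pmf.expectation (\<mu> k) (\<lambda>Q. choice Q q A))) / real K"
    by simp
  also have "\<dots> = J (time_share K)"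
    unfolding avg_clicks_def time_share_def sum_distrib_left sum_distrib_right sum_divide_distrib
    by (subst sum.swap, intro sum.cong refl, subst sum.swap, intro sum.cong refl,
        subst sum.swap, intro sum.cong refl, subst sum.swap, intro sum.cong refl) (simp add: mult_ac)
  finally show ?thesis ..
qed

lemma imp_time_share: "imp (time_share K) i = (\<Sum>k<K. mean_imp k i) / real K"
proof -
  have "mean_imp k i = imp (\<lambda>q A. measure_pmf.expectation (\<mu> k) (\<lambda>Q. choice Q q A)) i" for k
    unfolding mean_imp_def avg_impressions_def by (simp add: Bochner_Integration.integral_sum)
  then have "(\<Sum>k<K. mean_imp k i) / real K
      = (\<Sum>k<K. imp (\<lambda>q A. measure_pmf.expectation (\<mu> k) (\<lambda>Q. choice Q q A)) i) / real K"
    by simp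
  also have "\<dots> = imp (time_share K) i"
    unfolding avg_impressions_def time_share_def sum_distrib_left sum_distrib_right sum_divide_distrib
    by (subst sum.swap, intro sum.cong refl, subst sum.swap, intro sum.cong refl,
        subst sum.swap, intro sum.cong refl) (simp add: mult_ac)
  finally show ?thesis ..
qed

lemma time_share_randomization:
  assumes K: "K > 0"
  shows "time_share K \<in> randomizations nq \<M>"
  unfolding randomizations_def
proof (intro CollectI ballI conjI)
  fix q A
  have b: "0 \<le> measure_pmf.expectation (\<mu> k) (\<lambda>Q. choice Q q A)"
    "measure_pmf.expectation (\<mu> k) (\<lambda>Q. choice Q q A) \<le> 1" for k
  proof -
    show "0 \<le> measure_pmf.expectation (\<mu> k) (\<lambda>Q. choice Q q A)"
      by (intro integral_nonneg_AE AE_pmfI) (simp add: choice_def)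
    have "measure_pmf.expectation (\<mu> k) (\<lambda>Q. choice Q q A) \<le> measure_pmf.expectation (\<mu> k) (\<lambda>_. 1)"
      by (intro integral_mono integrable_queue_pmf) (simp add: choice_def)
    then show "measure_pmf.expectation (\<mu> k) (\<lambda>Q. choice Q q A) \<le> 1" by simp
  qed
  show "0 \<le> time_share K q A"
    unfolding time_share_def by (intro divide_nonneg_nonneg sum_nonneg b) simp
  have "(\<Sum>k<K. measure_pmf.expectation (\<mu> k) (\<lambda>Q. choice Q q A)) \<le> (\<Sum>k<K. 1)"
    by (intro sum_mono b)
  then show "time_share K q A \<le> 1"
    unfolding time_share_def using K by simp
next
  fix q assume q: "q \<in> {1..nq}"
  have "(\<Sum>A\<in>\<M> q. measure_pmf.expectation (\<mu> k) (\<lambda>Q. choice Q q A)) = 1" for k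
  proof -
    have "(\<Sum>A\<in>\<M> q. measure_pmf.expectation (\<mu> k) (\<lambda>Q. choice Q q A))
        = measure_pmf.expectation (\<mu> k) (\<lambda>Q. \<Sum>A\<in>\<M> q. choice Q q A)"
      by (simp add: Bochner_Integration.integral_sum)
    also have "\<dots> = measure_pmf.expectation (\<mu> k) (\<lambda>_. 1)"
      using choice_sum[OF q queue_pmf_nonneg, of _ k "\<lambda>_. 1"]
      by (intro integral_cong_AE AE_pmfI) auto
    finally show ?thesis by simp
  qed
  then have "(\<Sum>k<K. \<Sum>A\<in>\<M> q. measure_pmf.expectation (\<mu> k) (\<lambda>Q. choice Q q A)) = real K"
    by simp
  then show "(\<Sum>A\<in>\<M> q. time_share K q A) \<le> 1"
    unfolding time_share_def sum_divide_distrib[symmetric] using K by (subst sum.swap) simp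
qed

text \<open>The one-step bounds telescope: in the mean, whatever a client has missed after
  \<open>K\<close> cycles is still waiting in its queue.\<close>

lemma mean_imp_sum_ge: "real K * m i - mean_queue K i \<le> (\<Sum>k<K. mean_imp k i)"
proof -
  have "mean_queue 0 i + real K * m i - (\<Sum>k<K. mean_imp k i) \<le> mean_queue K i"
  proof (induction K)
    case (Suc K)
    then show ?case using mean_queue_Suc_ge[of K i] by (simp add: algebra_simps)
  qed simp
  then show ?thesis using mean_queue_nonneg[of 0 i] by linarith
qed

end

subsection \<open>Stability and the limit of the average click rate\<close>

locale ctr_model_slater = ctr_model N nq \<nu> \<epsilon> \<theta> \<M> c m Mstar Q0 qd
  for N nq :: nat
    and \<nu> \<epsilon> :: real
    and \<theta> :: "nat \<Rightarrow> real"
    and \<M> :: "nat \<Rightarrow> (real^'l^'n) set"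
    and c :: "nat \<Rightarrow> 'n \<Rightarrow> 'l \<Rightarrow> real"
    and m :: "'n \<Rightarrow> real"
    and Mstar :: "nat \<Rightarrow> real^'n \<Rightarrow> real^'l^'n"
    and Q0 :: "real^'n"
    and qd :: "nat pmf" +
  fixes phat :: "nat \<Rightarrow> real^'l^'n \<Rightarrow> real" and \<eta> :: real
  assumes phat: "phat \<in> randomizations nq \<M>"
    and \<eta>: "0 < \<eta>" "\<And>i. m i + \<eta> \<le> avg_impressions N nq \<nu> \<theta> \<M> phat i"
begin

text \<open>Bounds the mean growth of \<open>V\<close> per cycle in the comparison with the Slater
  point, whose clicks are at least 0 while those of the algorithm are at most \<open>n * L\<close>.
  The maximum with 0 makes the sign evident.\<close>

definition V_growth :: real where
  "V_growth = max 0 (\<Delta> + real N / \<epsilon> * (real CARD('n) * real CARD('l)))"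

text \<open>The slack \<open>\<eta>\<close> makes the queue term a negative drift. Keeping both
  terms on the left yields linear growth of \<open>mean_V\<close> as well as bounded time averages
  of the queues.\<close>

lemma mean_V_plus_queues_le:
  "mean_V K + \<eta> * (\<Sum>k<K. \<Sum>i\<in>UNIV. mean_queue k i) \<le> mean_V 0 + real K * V_growth"
proof (induction K)
  case (Suc K)
  have "(\<Sum>i\<in>UNIV. mean_queue K i * (m i - imp phat i)) \<le> (\<Sum>i\<in>UNIV. mean_queue K i * (- \<eta>))"
    using \<eta>(2) by (intro sum_mono mult_left_mono mean_queue_nonneg) (simp add: algebra_simps)
  then have "(\<Sum>i\<in>UNIV. mean_queue K i * (m i - imp phat i)) \<le> - (\<eta> * (\<Sum>i\<in>UNIV. mean_queue K i))"
    by (simp add: sum_distrib_left sum_negf mult.commute)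
  moreover have "real N / \<epsilon> * (mean_J K - J phat) \<le> real N / \<epsilon> * (real CARD('n) * real CARD('l))"
    using mean_J_bounds(2)[of K] J_bounds(1)[OF phat] \<epsilon> by (intro mult_left_mono) auto
  moreover have "\<Delta> + real N / \<epsilon> * (real CARD('n) * real CARD('l)) \<le> V_growth"
    by (simp add: V_growth_def)
  ultimately have "mean_V (Suc K) + \<eta> * (\<Sum>i\<in>UNIV. mean_queue K i) \<le> mean_V K + V_growth"
    using mean_V_Suc_le[OF phat, of K] by linarith
  then show ?case using Suc by (simp add: algebra_simps)
qed simp

lemma mean_V_le: "mean_V K \<le> mean_V 0 + real K * V_growth"
proof -
  have "0 \<le> \<eta> * (\<Sum>k<K. \<Sum>i\<in>UNIV. mean_queue k i)"
    using \<eta>(1) by (intro mult_nonneg_nonneg sum_nonneg mean_queue_nonneg) auto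
  then show ?thesis using mean_V_plus_queues_le[of K] by linarith
qed

lemma sum_queues_le:
  "(\<Sum>k<K. \<Sum>i\<in>UNIV. mean_queue k i) \<le> (mean_V 0 + V_growth) / \<eta> * real K"
proof (cases "K = 0")
  case False
  have "\<eta> * (\<Sum>k<K. \<Sum>i\<in>UNIV. mean_queue k i) \<le> mean_V 0 * 1 + real K * V_growth"
    using mean_V_plus_queues_le[of K] mean_V_nonneg[of K] by simp
  \<comment> \<open>For \<open>K \<ge> 1\<close> the initial term is absorbed into a multiple of
    \<open>K\<close>, because tightness asks for a bound proportional to \<open>K\<close> at every
    horizon.\<close>
  also have "\<dots> \<le> mean_V 0 * real K + real K * V_growth"
    using False mean_V_nonneg[of 0] by (intro add_right_mono mult_left_mono) auto
  finally show ?thesis using \<eta>(1) by (simp add: field_simps)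
qed simp

text \<open>Markov's inequality for the total queue, with a lattice box as the finite set. Only time
  averages of the mean queues are bounded, hence the averaged form of the tail condition.\<close>

lemma queue_pmf_tight:
  assumes "0 < e"
  shows "\<exists>F. finite F \<and> (\<forall>K. (\<Sum>k<K. measure_pmf.prob (\<mu> k) (- F)) \<le> e * real K)"
proof -
  define C where "C = (mean_V 0 + V_growth) / \<eta>"
  have C: "0 \<le> C"
    using mean_V_nonneg[of 0] \<eta>(1) by (simp add: C_def V_growth_def)
  \<comment> \<open>Makes \<open>C / R \<le> e\<close>; adding 1 keeps \<open>R\<close> positive
    when \<open>C = 0\<close>.\<close>
  define R where "R = (C + 1) / e"
  have R: "0 < R" using C assms by (simp add: R_def)
  define F where "F = {Q :: real^'n. \<forall>i. (Q $ i \<in> \<int> \<or> Q $ i - Q0 $ i \<in> \<int>) \<and> 0 \<le> Q $ i \<and> Q $ i \<le> R}"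
  have "measure_pmf.prob (\<mu> k) (- F) \<le> (\<Sum>i\<in>UNIV. mean_queue k i) / R" for k
  proof -
    have "measure_pmf.prob (\<mu> k) (- F) = measure_pmf.expectation (\<mu> k) (indicator (- F))"
      by simp
    also have "\<dots> \<le> measure_pmf.expectation (\<mu> k) (\<lambda>Q. (\<Sum>i\<in>UNIV. Q $ i) / R)"
    proof (intro integral_mono_AE AE_pmfI integrable_queue_pmf)
      fix Q assume Q: "Q \<in> set_pmf (\<mu> k)"
      note nn = queue_pmf_nonneg[OF Q]
      show "indicator (- F) Q \<le> (\<Sum>i\<in>UNIV. Q $ i) / R"
      proof (cases "Q \<in> F")
        case True
        then show ?thesis using nn R by (simp add: sum_nonneg)
      next
        case False
        then obtain i where "R < Q $ i"
          using queue_pmf_lattice[OF Q] nn unfolding F_def mem_Collect_eq by (meson not_le)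
        also have "Q $ i \<le> (\<Sum>i\<in>UNIV. Q $ i)"
          using nn by (intro member_le_sum) auto
        finally show ?thesis using False R by simp
      qed
    qed
    also have "\<dots> = (\<Sum>i\<in>UNIV. mean_queue k i) / R"
      by (simp add: mean_queue_def Bochner_Integration.integral_sum)
    finally show ?thesis .
  qed
  then have "(\<Sum>k<K. measure_pmf.prob (\<mu> k) (- F)) \<le> (\<Sum>k<K. (\<Sum>i\<in>UNIV. mean_queue k i) / R)" for K
    by (intro sum_mono)
  also have "(\<Sum>k<K. (\<Sum>i\<in>UNIV. mean_queue k i) / R) \<le> C * real K / R" for K
    unfolding sum_divide_distrib[symmetric] using sum_queues_le[of K] R
    by (intro divide_right_mono) (auto simp: C_def)
  also have "C * real K / R \<le> e * real K" for K
  proof -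
    have "C / R \<le> e" using C assms by (simp add: R_def field_simps)
    then show ?thesis using mult_right_mono[of "C / R" e "real K"] by simp
  qed
  finally have "(\<Sum>k<K. measure_pmf.prob (\<mu> k) (- F)) \<le> e * real K" for K .
  moreover have "finite F"
    unfolding F_def by (rule finite_bounded_lattice_points)
  ultimately show ?thesis by blast
qed

lemma mean_J_cesaro_convergent: "convergent (\<lambda>K. (\<Sum>k<K. mean_J k) / real K)"
proof -
  \<comment> \<open>The bounds on \<open>J\<close> need a nonnegative queue. The chain never leaves
    that region, so the cutoff does not change the expectations.\<close>
  define f where "f Q = (if nonneg Q then J (choice Q) else 0)" for Q
  have "convergent (\<lambda>K. (\<Sum>k<K. measure_pmf.expectation (\<mu> k) f) / real K)"
  proof (rule tight_chain_cesaro_convergent)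
    show "\<mu> (Suc k) = bind_pmf (\<mu> k) (\<lambda>Q. map_pmf (next_queue Q) \<beta>)" for k
      by simp
    show "\<bar>f Q\<bar> \<le> real CARD('n) * real CARD('l)" for Q
      using J_bounds[OF choice_randomization, of Q] by (auto simp: f_def)
  qed (rule queue_pmf_tight)
  moreover have "measure_pmf.expectation (\<mu> k) f = mean_J k" for k
    unfolding mean_J_def f_def using queue_pmf_nonneg by (intro integral_cong_AE AE_pmfI) auto
  ultimately show ?thesis by simp
qed

text \<open>\<open>mean_V\<close> grows at most linearly, so by \<open>mean_queue_le_sqrt\<close> a
  mean queue grows at most like the square root of \<open>K\<close>.\<close>

lemma mean_queue_rate_stable: "(\<lambda>K. (\<Sum>i\<in>UNIV. mean_queue K i) / real K) \<longlonglongrightarrow> 0"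
proof (rule tendsto_sandwich)
  show "\<forall>\<^sub>F K in sequentially. 0 \<le> (\<Sum>i\<in>UNIV. mean_queue K i) / real K"
    by (intro always_eventually allI divide_nonneg_nonneg sum_nonneg mean_queue_nonneg) auto
  show "\<forall>\<^sub>F K in sequentially. (\<Sum>i\<in>UNIV. mean_queue K i) / real K
      \<le> real CARD('n) * sqrt (2 * mean_V 0 / real K * (1 / real K) + 2 * V_growth / real K)"
  proof (rule eventually_sequentiallyI[of 1])
    fix K :: nat assume K: "1 \<le> K"
    have "mean_queue K i \<le> sqrt (2 * (mean_V 0 + real K * V_growth))" for i
      using mean_queue_le_sqrt[of K i] mean_V_le[of K]
      by (meson mult_left_mono order_trans real_sqrt_le_mono zero_le_numeral)
    then have "(\<Sum>i\<in>UNIV. mean_queue K i) \<le> (\<Sum>i\<in>(UNIV::'n set). sqrt (2 * (mean_V 0 + real K * V_growth)))"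
      by (intro sum_mono)
    then have "(\<Sum>i\<in>UNIV. mean_queue K i) / real K
        \<le> (\<Sum>i\<in>(UNIV::'n set). sqrt (2 * (mean_V 0 + real K * V_growth))) / real K"
      by (rule divide_right_mono) simp
    also have "\<dots> = real CARD('n) * (sqrt (2 * (mean_V 0 + real K * V_growth)) / sqrt ((real K)\<^sup>2))"
      by simp
    also have "\<dots> = real CARD('n) * sqrt (2 * mean_V 0 / real K * (1 / real K) + 2 * V_growth / real K)"
      unfolding real_sqrt_divide[symmetric] using K by (simp add: field_simps power2_eq_square)
    finally show "(\<Sum>i\<in>UNIV. mean_queue K i) / real K
      \<le> real CARD('n) * sqrt (2 * mean_V 0 / real K * (1 / real K) + 2 * V_growth / real K)" .
  qed
  have "(\<lambda>K. real CARD('n) * sqrt (2 * mean_V 0 / real K * (1 / real K) + 2 * V_growth / real K))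
      \<longlonglongrightarrow> real CARD('n) * sqrt (0 * 0 + 0)"
    by (intro tendsto_intros lim_const_over_n)
  then show "(\<lambda>K. real CARD('n) * sqrt (2 * mean_V 0 / real K * (1 / real K) + 2 * V_growth / real K)) \<longlonglongrightarrow> 0"
    by simp
qed simp

text \<open>
  The time-averaged placement frequencies miss the requirements by at most \<open>r\<close>, the total mean
  queue divided by \<open>K\<close>; mixing in the Slater point with weight \<open>r / (r + \<eta>)\<close> makes them feasible.
\<close>
lemma clicks_gap_lower:
  assumes opt: "\<And>p. p \<in> feasible N nq \<nu> \<theta> \<M> m \<Longrightarrow> J p \<le> J pstar" and K: "K > 0"
  shows "- (real CARD('n) * real CARD('l) / \<eta> * ((\<Sum>i\<in>UNIV. mean_queue K i) / real K))
    \<le> J pstar - (\<Sum>k<K. mean_J k) / real K"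
proof -
  define r where "r = (\<Sum>i\<in>UNIV. mean_queue K i) / real K"
  define \<delta> where "\<delta> = r / (r + \<eta>)"
  have r: "0 \<le> r"
    unfolding r_def by (intro divide_nonneg_nonneg sum_nonneg mean_queue_nonneg) auto
  have \<delta>: "0 \<le> \<delta>" "\<delta> \<le> 1" "\<delta> \<le> r / \<eta>" "(1 - \<delta>) * r = \<delta> * \<eta>"
    using r \<eta>(1) by (auto simp: \<delta>_def field_simps intro!: frac_le)
  let ?p = "\<lambda>q A. (1 - \<delta>) * time_share K q A + \<delta> * phat q A"
  have "m i \<le> imp ?p i" for i
  proof -
    have "mean_queue K i \<le> (\<Sum>i\<in>UNIV. mean_queue K i)"
      using mean_queue_nonneg by (intro member_le_sum) auto
    then have "real K * (m i - r) \<le> (\<Sum>k<K. mean_imp k i)"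
      using mean_imp_sum_ge[of K i] K by (simp add: r_def algebra_simps)
    then have "m i - r \<le> imp (time_share K) i"
      using K by (simp add: imp_time_share field_simps)
    then have "(1 - \<delta>) * (m i - r) + \<delta> * (m i + \<eta>) \<le> imp ?p i"
      unfolding avg_impressions_linear using \<delta> \<eta>(2)[of i] by (intro add_mono mult_left_mono) auto
    moreover have "(1 - \<delta>) * (m i - r) + \<delta> * (m i + \<eta>) = m i + (\<delta> * \<eta> - (1 - \<delta>) * r)"
      by (simp add: algebra_simps)
    ultimately show ?thesis using \<delta>(4) by simp
  qed
  moreover have "?p \<in> randomizations nq \<M>"
    using \<delta> K by (intro randomizations_convex time_share_randomization phat) auto
  ultimately have "J ?p \<le> J pstar"
    by (intro opt) (simp add: feasible_def)
  moreover have "J ?p = (1 - \<delta>) * J (time_share K) + \<delta> * J phat"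
    by (rule avg_clicks_linear)
  moreover have "0 \<le> \<delta> * J phat"
    using \<delta>(1) J_bounds(1)[OF phat] by simp
  \<comment> \<open>The Slater share contributes nonnegative clicks, so mixing costs at most the
    mass \<open>\<delta> \<le> r / \<eta>\<close> withdrawn from
    \<open>time_share K\<close>.\<close>
  moreover have "\<delta> * J (time_share K) \<le> r / \<eta> * (real CARD('n) * real CARD('l))"
    using \<delta> r \<eta>(1) J_bounds[OF time_share_randomization[OF K]] by (intro mult_mono) auto
  ultimately have "J (time_share K) - r / \<eta> * (real CARD('n) * real CARD('l)) \<le> J pstar"
    by (simp add: left_diff_distrib)
  then show ?thesis
    unfolding J_time_share r_def[symmetric] by (simp add: algebra_simps)
qed

theorem clicks_gap_limit:
  assumes pstar: "pstar \<in> feasible N nq \<nu> \<theta> \<M> m"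
    and opt: "\<And>p. p \<in> feasible N nq \<nu> \<theta> \<M> m \<Longrightarrow> J p \<le> J pstar"
  obtains l where "(\<lambda>K. J pstar - (\<Sum>k<K. mean_J k) / real K) \<longlonglongrightarrow> l" "0 \<le> l" "l \<le> \<Delta> * \<epsilon> / real N"
proof -
  let ?g = "\<lambda>K. J pstar - (\<Sum>k<K. mean_J k) / real K"
  obtain a where "(\<lambda>K. (\<Sum>k<K. mean_J k) / real K) \<longlonglongrightarrow> a"
    using mean_J_cesaro_convergent by (auto simp: convergent_def)
  then have lim: "?g \<longlonglongrightarrow> J pstar - a" by (intro tendsto_intros)
  have low: "(\<lambda>K. - (real CARD('n) * real CARD('l) / \<eta> * ((\<Sum>i\<in>UNIV. mean_queue K i) / real K)))
      \<longlonglongrightarrow> - (real CARD('n) * real CARD('l) / \<eta> * 0)"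
    by (intro tendsto_intros mean_queue_rate_stable)
  have ev: "\<forall>\<^sub>F K in sequentially. - (real CARD('n) * real CARD('l) / \<eta> * ((\<Sum>i\<in>UNIV. mean_queue K i) / real K)) \<le> ?g K"
    using clicks_gap_lower[where pstar=pstar] opt by (intro eventually_sequentiallyI[of 1]) auto
  have up: "(\<lambda>K. \<Delta> * \<epsilon> / real N + \<epsilon> * mean_V 0 / real N / real K) \<longlonglongrightarrow> \<Delta> * \<epsilon> / real N + 0"
    by (intro tendsto_intros lim_const_over_n)
  have ev': "\<forall>\<^sub>F K in sequentially. ?g K \<le> \<Delta> * \<epsilon> / real N + \<epsilon> * mean_V 0 / real N / real K"
    using clicks_gap_upper[OF pstar] by (intro eventually_sequentiallyI[of 1]) auto
  show ?thesis
  proof (rule that[OF lim])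
    show "0 \<le> J pstar - a"
      using tendsto_le[OF sequentially_bot lim low ev] by simp
    show "J pstar - a \<le> \<Delta> * \<epsilon> / real N"
      using tendsto_le[OF sequentially_bot up lim ev'] by simp
  qed
qed

end

subsection \<open>Expected clicks\<close>

context ctr_model
begin

lemma J_choice:
  assumes "nonneg Q"
  shows "J (choice Q) = (\<Sum>q=1..nq. \<nu> * \<theta> q * (\<Sum>i\<in>UNIV. \<Sum>s\<in>UNIV. Mstar q Q $ i $ s * c q i s))"
  unfolding avg_clicks_def using assms by (intro sum.cong refl) (simp add: choice_sum)

text \<open>Ordered like the sums in \<open>clicks\<close>, with the click rate factored out, so
  that expected clicks can be matched summand by summand.\<close>

lemma mean_J_eq:
  "mean_J k = (\<Sum>i\<in>UNIV. \<Sum>s\<in>UNIV. \<Sum>q=1..nq.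
      measure_pmf.expectation (\<mu> k) (\<lambda>Q. \<nu> * \<theta> q * Mstar q Q $ i $ s) * c q i s)"
proof -
  have "mean_J k = measure_pmf.expectation (\<mu> k)
      (\<lambda>Q. \<Sum>i\<in>UNIV. \<Sum>s\<in>UNIV. \<Sum>q=1..nq. \<nu> * \<theta> q * Mstar q Q $ i $ s * c q i s)"
    unfolding mean_J_def
  proof (intro integral_cong_AE AE_pmfI)
    fix Q assume "Q \<in> set_pmf (\<mu> k)"
    then have "J (choice Q) = (\<Sum>q=1..nq. \<Sum>i\<in>UNIV. \<Sum>s\<in>UNIV. \<nu> * \<theta> q * Mstar q Q $ i $ s * c q i s)"
      by (simp add: J_choice[OF queue_pmf_nonneg] sum_distrib_left mult.assoc)
    also have "\<dots> = (\<Sum>i\<in>UNIV. \<Sum>q=1..nq. \<Sum>s\<in>UNIV. \<nu> * \<theta> q * Mstar q Q $ i $ s * c q i s)"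
      by (rule sum.swap)
    also have "\<dots> = (\<Sum>i\<in>UNIV. \<Sum>s\<in>UNIV. \<Sum>q=1..nq. \<nu> * \<theta> q * Mstar q Q $ i $ s * c q i s)"
      by (intro sum.cong refl sum.swap)
    finally show "J (choice Q) = \<dots>" .
  qed simp_all
  also have "\<dots> = (\<Sum>i\<in>UNIV. \<Sum>s\<in>UNIV. \<Sum>q=1..nq.
      measure_pmf.expectation (\<mu> k) (\<lambda>Q. \<nu> * \<theta> q * Mstar q Q $ i $ s * c q i s))"
    by (simp only: Bochner_Integration.integral_sum integrable_queue_pmf)
  finally show ?thesis by simp
qed

section \<open>Transfer from the sample space to the queue chain\<close>

context
  fixes P :: "'w measure" and qt ct mt
  assumes P: "prob_space P"
    and indep: "prob_space.indep_vars P (\<lambda>_. count_space UNIV) (observation qt ct mt) (sources nq)"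
    and qt_range: "\<And>t \<omega>. \<omega> \<in> space P \<Longrightarrow> qt t \<omega> \<le> nq"
    and qt_law: "\<And>t. distr P (count_space UNIV) (qt t) = measure_pmf qd"
    and ct_law: "\<And>q i s t. q \<in> {1..nq} \<Longrightarrow> distr P (count_space UNIV) (ct q i s t)
          = measure_pmf (map_pmf of_bool (bernoulli_pmf (c q i s)))"
    and mt_law: "\<And>i k. distr P (count_space UNIV) (mt i k) = measure_pmf (rounding_pmf (m i))"
begin

lemma sources_upto_subset: "sources_upto N k \<subseteq> sources nq"
  by (auto simp: sources_upto_def sources_def)

text \<open>Padding with 0 makes the law literally a \<open>Pi_pmf\<close>; index \<open>k\<close>
  covers the cycles before \<open>k\<close>.\<close>

definition history :: "nat \<Rightarrow> 'w \<Rightarrow> ('n, 'l) source \<Rightarrow> nat" where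
  "history k \<omega> x = (if x \<in> sources_upto N k then observation qt ct mt x \<omega> else 0)"

lemma history_law:
  "history k \<in> measurable P (count_space UNIV)"
  "distr P (count_space UNIV) (history k) = measure_pmf (Pi_pmf (sources_upto N k) 0 (source_law qd c m))"
proof -
  interpret prob_space P by (rule P)
  have i: "indep_vars (\<lambda>_. count_space UNIV) (observation qt ct mt) (sources_upto N k)"
    using indep sources_upto_subset by (rule indep_vars_subset)
  have l: "distr P (count_space UNIV) (observation qt ct mt x) = measure_pmf (source_law qd c m x)"
    if "x \<in> sources_upto N k" for x
    using that by (cases rule: sources_upto_cases) (simp_all add: qt_law mt_law)
  show "history k \<in> measurable P (count_space UNIV)"
    "distr P (count_space UNIV) (history k) = measure_pmf (Pi_pmf (sources_upto N k) 0 (source_law qd c m))"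
    using distr_indep_vars_eq_Pi_pmf[OF finite_sources_upto i l, of 0]
    unfolding history_def[abs_def] by auto
qed

text \<open>A longer history is allowed because the clicks of cycle \<open>k\<close> also need the
  queries of that cycle, which \<open>history (Suc k)\<close> contains.\<close>

lemma queue_eq_history: "queue N Mstar qt mt Q0 k \<omega> = coordinate_queue N Mstar Q0 k (history k' \<omega>)"
  if "k \<le> k'"
  unfolding coordinate_queue_def
proof (rule queue_cong)
  fix t assume "t < k * N"
  then have "t < k' * N" using that by (meson less_le_trans mult_le_mono1)
  then show "qt t \<omega> = history k' \<omega> (Query t)" by (simp add: history_def)
qed (use that in \<open>simp add: history_def\<close>)

lemma expectation_history:
  fixes g :: "_ \<Rightarrow> real"
  shows "integrable P (\<lambda>\<omega>. g (history k \<omega>))"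
    and "(\<integral>\<omega>. g (history k \<omega>) \<partial>P)
      = measure_pmf.expectation (Pi_pmf (sources_upto N k) 0 (source_law qd c m)) g"
proof -
  have "integrable (distr P (count_space UNIV) (history k)) g"
    unfolding history_law(2) by (rule integrable_measure_pmf_finite) (rule finite_set_sources_pmf)
  then show "integrable P (\<lambda>\<omega>. g (history k \<omega>))"
    by (rule integrable_distr[OF history_law(1)])
  show "(\<integral>\<omega>. g (history k \<omega>) \<partial>P)
      = measure_pmf.expectation (Pi_pmf (sources_upto N k) 0 (source_law qd c m)) g"
    unfolding history_law(2)[symmetric] by (rule integral_distr[symmetric, OF history_law(1)]) simp
qed

lemma expectation_click:
  assumes "q \<in> {1..nq}"
  shows "integrable P (\<lambda>\<omega>. real (ct q i s t \<omega>))" and "(\<integral>\<omega>. real (ct q i s t \<omega>) \<partial>P) = c q i s"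
proof -
  interpret prob_space P by (rule P)
  have "Click q i s t \<in> sources nq"
    using assms by (auto simp: sources_def)
  then have "observation qt ct mt (Click q i s t) \<in> measurable P (count_space UNIV)"
    using indep unfolding indep_vars_def by blast
  then have meas: "ct q i s t \<in> measurable P (count_space UNIV)" by simp
  let ?b = "map_pmf of_bool (bernoulli_pmf (c q i s)) :: nat pmf"
  have "integrable (distr P (count_space UNIV) (ct q i s t)) real"
    unfolding ct_law[OF assms] by (rule integrable_measure_pmf_finite) simp
  then show "integrable P (\<lambda>\<omega>. real (ct q i s t \<omega>))"
    by (rule integrable_distr[OF meas])
  have "(\<integral>\<omega>. real (ct q i s t \<omega>) \<partial>P) = integral\<^sup>L (distr P (count_space UNIV) (ct q i s t)) real"
    by (rule integral_distr[symmetric, OF meas]) simp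
  also have "\<dots> = c q i s"
    unfolding ct_law[OF assms] integral_map_pmf using c[OF assms, of i s]
    by (subst integral_bernoulli_pmf) auto
  finally show "(\<integral>\<omega>. real (ct q i s t \<omega>) \<partial>P) = c q i s" .
qed

text \<open>No click belongs to the history, so splitting the independent family into two disjoint
  blocks makes the factors independent. Any \<open>g\<close> is admissible because a finite product
  of countable discrete spaces is discrete.\<close>

lemma history_click_product:
  fixes g :: "_ \<Rightarrow> real"
  assumes q: "q \<in> {1..nq}"
  shows "integrable P (\<lambda>\<omega>. g (history k \<omega>) * real (ct q i s t \<omega>))"
    and "(\<integral>\<omega>. g (history k \<omega>) * real (ct q i s t \<omega>) \<partial>P)
      = measure_pmf.expectation (Pi_pmf (sources_upto N k) 0 (source_law qd c m)) g * c q i s"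
proof -
  interpret prob_space P by (rule P)
  let ?A = "sources_upto N k :: ('n, 'l) source set" and ?B = "{Click q i s t}"
  let ?C = "\<lambda>_. count_space UNIV :: nat measure"
  have "indep_var (PiM ?A ?C) (\<lambda>\<omega>. restrict (\<lambda>x. observation qt ct mt x \<omega>) ?A)
      (PiM ?B ?C) (\<lambda>\<omega>. restrict (\<lambda>x. observation qt ct mt x \<omega>) ?B)"
  proof (rule indep_var_restrict[OF indep _ sources_upto_subset])
    show "?A \<inter> ?B = {}" by simp
    show "?B \<subseteq> sources nq" using q by (auto simp: sources_def)
  qed
  moreover have "(\<lambda>v. g (\<lambda>x. if x \<in> ?A then v x else 0)) \<in> borel_measurable (PiM ?A ?C)"
  proof -
    have "PiM ?A ?C = count_space (PiE ?A (\<lambda>_. UNIV))"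
      by (rule count_space_PiM_finite) (simp_all add: finite_sources_upto)
    then show ?thesis by simp
  qed
  moreover have "(\<lambda>v. real (v (Click q i s t))) \<in> borel_measurable (PiM ?B ?C)"
    by measurable
  ultimately have "indep_var borel ((\<lambda>v. g (\<lambda>x. if x \<in> ?A then v x else 0)) \<circ> (\<lambda>\<omega>. restrict (\<lambda>x. observation qt ct mt x \<omega>) ?A))
      borel ((\<lambda>v. real (v (Click q i s t))) \<circ> (\<lambda>\<omega>. restrict (\<lambda>x. observation qt ct mt x \<omega>) ?B))"
    by (rule indep_var_compose)
  moreover have "(\<lambda>v. g (\<lambda>x. if x \<in> ?A then v x else 0)) \<circ> (\<lambda>\<omega>. restrict (\<lambda>x. observation qt ct mt x \<omega>) ?A)
      = (\<lambda>\<omega>. g (history k \<omega>))"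
    by (auto simp: o_def history_def[abs_def] cong: if_cong)
  moreover have "(\<lambda>v. real (v (Click q i s t))) \<circ> (\<lambda>\<omega>. restrict (\<lambda>x. observation qt ct mt x \<omega>) ?B)
      = (\<lambda>\<omega>. real (ct q i s t \<omega>))"
    by (auto simp: o_def)
  ultimately have ind: "indep_var borel (\<lambda>\<omega>. g (history k \<omega>)) borel (\<lambda>\<omega>. real (ct q i s t \<omega>))"
    by simp
  show "integrable P (\<lambda>\<omega>. g (history k \<omega>) * real (ct q i s t \<omega>))"
    by (rule indep_var_integrable[OF ind expectation_history(1) expectation_click(1)[OF q]])
  show "(\<integral>\<omega>. g (history k \<omega>) * real (ct q i s t \<omega>) \<partial>P)
      = measure_pmf.expectation (Pi_pmf (sources_upto N k) 0 (source_law qd c m)) g * c q i s"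
    using indep_var_lebesgue_integral[OF ind expectation_history(1) expectation_click(1)[OF q]]
    by (simp only: expectation_history(2) expectation_click(2)[OF q])
qed

text \<open>The queue at the start of a cycle is independent of the queries inside it, so the query
  indicator integrates to the keyword probability.\<close>

lemma expectation_shown:
  assumes q: "q \<in> {1..nq}" and t: "t \<in> {k * N..<(k + 1) * N}"
  shows "measure_pmf.expectation (Pi_pmf (sources_upto N (Suc k)) 0 (source_law qd c m))
      (\<lambda>v. of_bool (v (Query t) = q) * Mstar q (coordinate_queue N Mstar Q0 k v) $ i $ s)
    = measure_pmf.expectation (\<mu> k) (\<lambda>Q. \<nu> * \<theta> q * Mstar q Q $ i $ s)"
proof -
  define r where "r = t - k * N"
  have r: "r < N" "t = k * N + r" using t by (auto simp: r_def)
  let ?P = "Pi_pmf (sources_upto N (Suc k)) 0 (source_law qd c m)"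
  let ?h = "\<lambda>(Q, b). of_bool (b (Query r) = q) * Mstar q Q $ i $ s"
  have "measure_pmf.expectation ?P
      (\<lambda>v. of_bool (v (Query t) = q) * Mstar q (coordinate_queue N Mstar Q0 k v) $ i $ s)
    = measure_pmf.expectation
        (map_pmf (\<lambda>v. (coordinate_queue N Mstar Q0 k v, cycle_data N k v)) ?P) ?h"
    using r by (simp add: cycle_data_def)
  also have "\<dots> = measure_pmf.expectation (pair_pmf (\<mu> k) \<beta>) ?h"
    by (simp only: map_queue_cycle_data[where D="source_law qd c m", OF source_law_shift]
        map_coordinate_queue[where D="source_law qd c m", OF source_law_shift])
  also have "\<dots> = measure_pmf.expectation (\<mu> k)
      (\<lambda>Q. measure_pmf.expectation \<beta> (\<lambda>b. of_bool (b (Query r) = q) * Mstar q Q $ i $ s))"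
    by (simp only: expectation_pair_pmf_finite[OF finite_set_queue_pmf finite_set_cycle_pmf] prod.case)
  also have "\<dots> = measure_pmf.expectation (\<mu> k) (\<lambda>Q. \<nu> * \<theta> q * Mstar q Q $ i $ s)"
  proof -
    have "measure_pmf.expectation \<beta> (\<lambda>b. of_bool (b (Query r) = q) * x) = \<nu> * \<theta> q * x" for x :: real
    proof -
      have "measure_pmf.expectation \<beta> (\<lambda>b. of_bool (b (Query r) = q) * x)
          = (\<Sum>q'=1..nq. \<nu> * \<theta> q' * (of_bool (q' = q) * x))"
        by (rule expectation_Query[OF r(1), of "\<lambda>q'. of_bool (q' = q) * x"]) (use q in auto)
      also have "\<dots> = (\<Sum>q'=1..nq. if q' = q then \<nu> * \<theta> q * x else 0)"
        by (intro sum.cong) auto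
      finally show ?thesis using q by simp
    qed
    then show ?thesis by simp
  qed
  finally show ?thesis .
qed

lemma expected_clicks:
  shows "integrable P (clicks N Mstar qt ct mt Q0 k)"
    and "(\<integral>\<omega>. clicks N Mstar qt ct mt Q0 k \<omega> \<partial>P) = real N * mean_J k"
proof -
  let ?T = "{k * N..<(k + 1) * N}"
  let ?g = "\<lambda>t i s q v. of_bool (v (Query t) = q) * Mstar q (coordinate_queue N Mstar Q0 k v) $ i $ s"
  \<comment> \<open>The click variable in \<open>clicks\<close> is indexed by the random query.
    Summing over all keywords with the query's indicator fixes the index, so independence applies to
    each summand; an empty slot gives 0 on both sides.\<close>
  let ?F = "\<lambda>\<omega>. \<Sum>t\<in>?T. \<Sum>i\<in>UNIV. \<Sum>s\<in>UNIV. \<Sum>q=1..nq. ?g t i s q (history (Suc k) \<omega>) * real (ct q i s t \<omega>)"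
  have eq: "clicks N Mstar qt ct mt Q0 k \<omega> = ?F \<omega>" if \<omega>: "\<omega> \<in> space P" for \<omega>
    unfolding clicks_def
  proof (intro sum.cong refl)
    fix t i s assume t: "t \<in> ?T"
    let ?Q = "queue N Mstar qt mt Q0 k \<omega>"
    have "(\<Sum>q=1..nq. ?g t i s q (history (Suc k) \<omega>) * real (ct q i s t \<omega>))
        = (\<Sum>q=1..nq. if q = qt t \<omega> then Mstar q ?Q $ i $ s * real (ct q i s t \<omega>) else 0)"
      using t queue_eq_history[of k "Suc k" \<omega>] by (intro sum.cong) (auto simp: history_def)
    also have "\<dots> = shown Mstar (qt t \<omega>) ?Q $ i $ s * real (ct (qt t \<omega>) i s t \<omega>)"
      using qt_range[OF \<omega>, of t] by (auto simp: shown_def)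
    finally show "shown Mstar (qt t \<omega>) ?Q $ i $ s * real (ct (qt t \<omega>) i s t \<omega>)
        = (\<Sum>q=1..nq. ?g t i s q (history (Suc k) \<omega>) * real (ct q i s t \<omega>))" ..
  qed
  have int: "integrable P (\<lambda>\<omega>. ?g t i s q (history (Suc k) \<omega>) * real (ct q i s t \<omega>))" if "q \<in> {1..nq}" for t i s q
    using that by (rule history_click_product(1)[where g="?g t i s q"])
  have "integrable P ?F"
    by (intro Bochner_Integration.integrable_sum int)
  then show "integrable P (clicks N Mstar qt ct mt Q0 k)"
    using eq by (subst Bochner_Integration.integrable_cong[OF refl]) auto
  have "(\<integral>\<omega>. clicks N Mstar qt ct mt Q0 k \<omega> \<partial>P) = (\<integral>\<omega>. ?F \<omega> \<partial>P)"
    using eq by (intro Bochner_Integration.integral_cong) auto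
  also have "\<dots> = (\<Sum>t\<in>?T. \<Sum>i\<in>UNIV. \<Sum>s\<in>UNIV. \<Sum>q=1..nq.
      \<integral>\<omega>. ?g t i s q (history (Suc k) \<omega>) * real (ct q i s t \<omega>) \<partial>P)"
  proof -
    have int1: "integrable P (\<lambda>\<omega>. \<Sum>q=1..nq. ?g t i s q (history (Suc k) \<omega>) * real (ct q i s t \<omega>))" for t i s
      by (intro Bochner_Integration.integrable_sum int)
    have "(\<integral>\<omega>. (\<Sum>q=1..nq. ?g t i s q (history (Suc k) \<omega>) * real (ct q i s t \<omega>)) \<partial>P)
        = (\<Sum>q=1..nq. \<integral>\<omega>. ?g t i s q (history (Suc k) \<omega>) * real (ct q i s t \<omega>) \<partial>P)" for t i s
      by (intro Bochner_Integration.integral_sum int)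
    then show ?thesis
      by (simp only: Bochner_Integration.integral_sum Bochner_Integration.integrable_sum int1)
  qed
  also have "\<dots> = (\<Sum>t\<in>?T. mean_J k)"
    unfolding mean_J_eq
  proof (intro sum.cong refl)
    fix t i s q assume t: "t \<in> ?T" and q: "q \<in> {1..nq}"
    show "(\<integral>\<omega>. ?g t i s q (history (Suc k) \<omega>) * real (ct q i s t \<omega>) \<partial>P)
        = measure_pmf.expectation (\<mu> k) (\<lambda>Q. \<nu> * \<theta> q * Mstar q Q $ i $ s) * c q i s"
      unfolding history_click_product(2)[where g="?g t i s q", OF q] expectation_shown[OF q t] ..
  qed
  also have "\<dots> = real N * mean_J k" by simp
  finally show "(\<integral>\<omega>. clicks N Mstar qt ct mt Q0 k \<omega> \<partial>P) = real N * mean_J k" .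
qed

lemma expected_clicks_gap:
  "(\<integral>\<omega>. a - 1 / (real K * real N) * (\<Sum>k<K. clicks N Mstar qt ct mt Q0 k \<omega>) \<partial>P)
    = a - (\<Sum>k<K. mean_J k) / real K"
proof -
  interpret prob_space P by (rule P)
  have "(\<integral>\<omega>. a - 1 / (real K * real N) * (\<Sum>k<K. clicks N Mstar qt ct mt Q0 k \<omega>) \<partial>P)
      = a - 1 / (real K * real N) * (\<Sum>k<K. \<integral>\<omega>. clicks N Mstar qt ct mt Q0 k \<omega> \<partial>P)"
    using expected_clicks(1) by (simp add: prob_space Bochner_Integration.integral_sum)
  also have "\<dots> = a - (\<Sum>k<K. mean_J k) / real K"
    using N by (simp add: expected_clicks(2) sum_distrib_left[symmetric])
  finally show ?thesis .
qed

end

end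

text \<open>Packages query probabilities given value by value as the pmf that drives the
  chain.\<close>

lemma query_pmf_exists:
  fixes \<nu> :: real
  assumes \<nu>: "0 \<le> \<nu>" "\<nu> \<le> 1" and \<theta>: "\<And>q. q \<in> {1..nq} \<Longrightarrow> 0 \<le> \<theta> q" "(\<Sum>q=1..nq. \<theta> q) = 1"
  obtains qd :: "nat pmf" where "pmf qd 0 = 1 - \<nu>" "\<And>q. q \<in> {1..nq} \<Longrightarrow> pmf qd q = \<nu> * \<theta> q" "set_pmf qd \<subseteq> {0..nq}"
proof
  define w where "w q = (if q = 0 then 1 - \<nu> else if q \<le> nq then \<nu> * \<theta> q else 0)" for q
  have w0: "0 \<le> w q" for q
    using \<nu> \<theta>(1) by (auto simp: w_def)
  have "(\<integral>\<^sup>+ q. ennreal (w q) \<partial>count_space UNIV) = (\<Sum>q\<in>{0..nq}. ennreal (w q))"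
    by (intro nn_integral_count_space') (auto simp: w_def)
  also have "\<dots> = ennreal (\<Sum>q\<in>{0..nq}. w q)"
    using w0 by simp
  also have "(\<Sum>q\<in>{0..nq}. w q) = w 0 + (\<Sum>q=1..nq. w q)"
    by (simp add: sum.atLeast_Suc_atMost)
  also have "(\<Sum>q=1..nq. w q) = (\<Sum>q=1..nq. \<nu> * \<theta> q)"
    by (intro sum.cong) (auto simp: w_def)
  also have "w 0 + \<dots> = 1"
    using \<theta>(2) by (simp add: w_def sum_distrib_left[symmetric])
  finally have pmf_w: "pmf (embed_pmf w) q = w q" for q
    using w0 by (intro pmf_embed_pmf) auto
  show "pmf (embed_pmf w) 0 = 1 - \<nu>" by (simp add: pmf_w w_def)
  show "pmf (embed_pmf w) q = \<nu> * \<theta> q" if "q \<in> {1..nq}" for q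
    using that by (simp add: pmf_w w_def)
  show "set_pmf (embed_pmf w) \<subseteq> {0..nq}"
    by (auto simp: set_pmf_iff pmf_w w_def split: if_splits)
qed

theorem theorem5:
  fixes P :: "'w measure"
    and N nq :: nat
    and \<nu> \<epsilon> D1 :: real
    and \<theta> :: "nat \<Rightarrow> real"
    and \<M> :: "nat \<Rightarrow> (real^'l^'n) set"
    and c :: "nat \<Rightarrow> 'n \<Rightarrow> 'l \<Rightarrow> real"
    and m :: "'n \<Rightarrow> real"
    and qt :: "nat \<Rightarrow> 'w \<Rightarrow> nat"
    and ct :: "nat \<Rightarrow> 'n \<Rightarrow> 'l \<Rightarrow> nat \<Rightarrow> 'w \<Rightarrow> nat"
    and mt :: "'n \<Rightarrow> nat \<Rightarrow> 'w \<Rightarrow> nat"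
    and Mstar :: "nat \<Rightarrow> real^'n \<Rightarrow> real^'l^'n"
    and Q0 :: "real^'n"
    and pstar :: "nat \<Rightarrow> real^'l^'n \<Rightarrow> real"
  assumes "N \<ge> 1" and "nq \<ge> 1"
    and "0 < \<nu>" and "\<nu> < 1"
    and "\<And>q. q \<in> {1..nq} \<Longrightarrow> 0 \<le> \<theta> q" and "(\<Sum>q=1..nq. \<theta> q) = 1"
    and "\<And>q. q \<in> {1..nq} \<Longrightarrow> \<M> q \<noteq> {}"
    and "\<And>q M. q \<in> {1..nq} \<Longrightarrow> M \<in> \<M> q \<Longrightarrow> placement_matrix M"
    and "\<And>q i s. q \<in> {1..nq} \<Longrightarrow> 0 \<le> c q i s \<and> c q i s \<le> 1"
    and "\<And>i. 0 < m i"
    and "ctr_randomness P nq \<nu> \<theta> c m qt ct mt"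
    and slater: "\<exists>phat \<in> feasible N nq \<nu> \<theta> \<M> m.
                   (MIN i. avg_impressions N nq \<nu> \<theta> \<M> phat i - m i) > 0"
    and optimal: "is_arg_max (avg_clicks nq \<nu> \<theta> \<M> c) (\<lambda>p. p \<in> feasible N nq \<nu> \<theta> \<M> m) pstar"
    and "0 < \<epsilon>"
    and "max_weight_rule nq \<M> c \<epsilon> Mstar"
    and "\<And>i. 0 \<le> Q0 $ i"
    and D1_eq: "D1 = 1 / 2 * (real N * (real N - 1) * (real CARD('l))\<^sup>2 + real N * real CARD('l)
           + (\<Sum>i\<in>UNIV. (of_int \<lceil>m i\<rceil>)\<^sup>2 * (m i - of_int \<lfloor>m i\<rfloor>)
                       + (of_int \<lfloor>m i\<rfloor>)\<^sup>2 * (1 - m i + of_int \<lfloor>m i\<rfloor>)))"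
  shows "D1 > 0 \<and>
    (\<exists>l. (\<lambda>K. \<integral>\<omega>. avg_clicks nq \<nu> \<theta> \<M> c pstar
                  - 1 / (real K * real N) * (\<Sum>k<K. clicks N Mstar qt ct mt Q0 k \<omega>) \<partial>P)
            \<longlonglongrightarrow> l
         \<and> 0 \<le> l \<and> l \<le> D1 * \<epsilon> / real N)"
proof
  show "D1 > 0"
  proof -
    have requirements: "0 \<le> (\<Sum>i\<in>UNIV. (of_int \<lceil>m i\<rceil>)\<^sup>2 * (m i - of_int \<lfloor>m i\<rfloor>)
                       + (of_int \<lfloor>m i\<rfloor>)\<^sup>2 * (1 - m i + of_int \<lfloor>m i\<rfloor>))"
      by (intro sum_nonneg add_nonneg_nonneg[OF mult_nonneg_nonneg[OF zero_le_power2]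
            mult_nonneg_nonneg[OF zero_le_power2]]) linarith+
    \<comment> \<open>Strict positivity comes from \<open>N * L\<close>; the other terms are only
      nonnegative.\<close>
    have service: "0 \<le> real N * (real N - 1) * (real CARD('l))\<^sup>2" "0 < real N * real CARD('l)"
      using assms(1) by simp_all
    show ?thesis
      unfolding D1_eq by (rule mult_pos_pos[OF _ add_pos_nonneg[OF add_nonneg_pos[OF service] requirements]]) simp
  qed
  have rnd: "prob_space P"
    "prob_space.indep_vars P (\<lambda>_. count_space UNIV) (observation qt ct mt) (sources nq)"
    "\<And>t \<omega>. \<omega> \<in> space P \<Longrightarrow> qt t \<omega> \<in> {0..nq}"
    "\<And>t. measure P {\<omega> \<in> space P. qt t \<omega> = 0} = 1 - \<nu>"
    "\<And>t q. q \<in> {1..nq} \<Longrightarrow> measure P {\<omega> \<in> space P. qt t \<omega> = q} = \<nu> * \<theta> q"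
    "\<And>q i s t. q \<in> {1..nq} \<Longrightarrow> distr P (count_space UNIV) (ct q i s t)
          = measure_pmf (map_pmf of_bool (bernoulli_pmf (c q i s)))"
    "\<And>i k. distr P (count_space UNIV) (mt i k) = measure_pmf (rounding_pmf (m i))"
    using assms(11) by (auto simp: ctr_randomness_def)
  obtain qd where qd: "pmf qd 0 = 1 - \<nu>" "\<And>q. q \<in> {1..nq} \<Longrightarrow> pmf qd q = \<nu> * \<theta> q" "set_pmf qd \<subseteq> {0..nq}"
    using query_pmf_exists[OF less_imp_le[OF assms(3)] less_imp_le[OF assms(4)] assms(5,6)] by blast
  \<comment> \<open>Values beyond \<open>nq\<close> have probability 0 by the range condition, so
    the given probabilities determine the law on singletons, and it is the same in every
    slot.\<close>
  have qt_law: "distr P (count_space UNIV) (qt t) = measure_pmf qd" for t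
  proof -
    interpret prob_space P by (rule rnd(1))
    have "observation qt ct mt (Query t) \<in> measurable P (count_space UNIV)"
      using rnd(2) unfolding indep_vars_def sources_def by blast
    then have meas: "qt t \<in> measurable P (count_space UNIV)" by simp
    show ?thesis
    proof (rule measure_eqI_countable[where A=UNIV])
      fix q
      have "qt t -` {q} \<inter> space P = {\<omega> \<in> space P. qt t \<omega> = q}" by auto
      moreover have "measure P {\<omega> \<in> space P. qt t \<omega> = q} = pmf qd q"
      proof -
        consider "q = 0" | "q \<in> {1..nq}" | "q \<notin> {0..nq}" by force
        then show ?thesis
        proof cases
          case 3
          then have "{\<omega> \<in> space P. qt t \<omega> = q} = {}" using rnd(3) by blast
          moreover have "pmf qd q = 0" using 3 qd(3) by (auto simp: set_pmf_iff)
          ultimately show ?thesis by (simp only: measure_empty)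
        qed (use rnd(4,5) qd(1,2) in auto)
      qed
      ultimately show "emeasure (distr P (count_space UNIV) (qt t)) {q} = emeasure (measure_pmf qd) {q}"
        using meas by (simp add: emeasure_distr emeasure_eq_measure emeasure_pmf_single)
    qed auto
  qed
  obtain phat where phat: "phat \<in> feasible N nq \<nu> \<theta> \<M> m"
    and pos: "(MIN i. avg_impressions N nq \<nu> \<theta> \<M> phat i - m i) > 0"
    using slater by blast
  \<comment> \<open>A slack common to all clients, positive because the minimum runs over finitely
    many of them.\<close>
  define \<eta> where "\<eta> = (MIN i. avg_impressions N nq \<nu> \<theta> \<M> phat i - m i)"
  have \<eta>: "m i + \<eta> \<le> avg_impressions N nq \<nu> \<theta> \<M> phat i" for i
  proof -
    have "\<eta> \<le> avg_impressions N nq \<nu> \<theta> \<M> phat i - m i"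
      unfolding \<eta>_def by (rule Min_le) auto
    then show ?thesis by linarith
  qed
  have "ctr_model N nq \<nu> \<epsilon> \<theta> \<M> c m Mstar Q0 qd"
    by (rule ctr_model.intro; fact assms qd(2,3) less_imp_le[OF assms(3)] less_imp_le[OF assms(4)] less_imp_le[OF assms(10)])
  moreover have "ctr_model_slater_axioms N nq \<nu> \<theta> \<M> m phat \<eta>"
    using phat pos \<eta> by (simp add: ctr_model_slater_axioms_def feasible_def \<eta>_def)
  ultimately interpret ctr_model_slater N nq \<nu> \<epsilon> \<theta> \<M> c m Mstar Q0 qd phat \<eta>
    by (rule ctr_model_slater.intro)
  have pstar: "pstar \<in> feasible N nq \<nu> \<theta> \<M> m"
    and opt: "\<And>p. p \<in> feasible N nq \<nu> \<theta> \<M> m \<Longrightarrow> J p \<le> J pstar"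
    using optimal unfolding is_arg_max_linorder by blast+
  obtain l where "(\<lambda>K. J pstar - (\<Sum>k<K. mean_J k) / real K) \<longlonglongrightarrow> l" "0 \<le> l" "l \<le> \<Delta> * \<epsilon> / real N"
    using clicks_gap_limit[OF pstar opt] by blast
  moreover have "\<Delta> = D1" by (simp only: \<Delta>_def D1_eq)
  moreover have "(\<integral>\<omega>. J pstar - 1 / (real K * real N) * (\<Sum>k<K. clicks N Mstar qt ct mt Q0 k \<omega>) \<partial>P)
      = J pstar - (\<Sum>k<K. mean_J k) / real K" for K
    using rnd(3) by (intro expected_clicks_gap rnd(1,2,6,7) qt_law) auto
  ultimately show "\<exists>l. (\<lambda>K. \<integral>\<omega>. J pstar - 1 / (real K * real N) * (\<Sum>k<K. clicks N Mstar qt ct mt Q0 k \<omega>) \<partial>P) \<longlonglongrightarrow> l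
         \<and> 0 \<le> l \<and> l \<le> D1 * \<epsilon> / real N"
    by (simp only:) blast
qed

end
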